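(* Consider the facility location problem on a random shortest path metric on $n$ vertices with opening costs $0<f_1\le\dots\le f_n$ (which may depend on $n$), and assume there is a constant $q$ with $f_n/f_1\le n^q$ for all $n$. Let $F_k=\sum_{i=1}^k f_i$. Define $\kappa:=\max\{i\in[n]: f_i<1/(i-1)\}$ and assume $\kappa\in\Theta(n)$. Let $\mathsf{ALG}$ denote the total cost of the solution which opens, independently of the metric, the facilities with opening costs $f_1,\ldots,f_\kappa$, and let $\mathsf{OPT}$ be the optimal cost. Then $$\mathbb{E}\left[\frac{\mathsf{ALG}}{\mathsf{OPT}}\right]\le\sqrt{\max\left\{\frac1{F_n^2},\max_{k\in[n-1]}O\left(\frac{n^4F_{n-k}+kn^2}{n^4F_{n-k}^3+k^4F_{n-k}}\right)\right\}}+\sqrt[4]{O\left(\frac{n^6F_{n-1}^2+n^2}{n^8F_{n-1}^7+F_{n-1}^3}+\frac{n^{10}F_{n-2}^3+n^4}{n^{14}F_{n-2}^9+F_{n-2}^2}+\sum_{k=3}^{n-1}\frac{k^3n^{12}F_{n-k}^3+k^9n^6}{n^{16}F_{n-k}^9+k^{16}F_{n-k}}\right)}.$$ Moreover, if $\kappa=n$, then $$\mathbb{E}\left[\frac{\mathsf{ALG}}{\mathsf{OPT}}\right]\le F_n\sqrt{\max\left\{\frac1{F_n^2},\max_{k\in[n-1]}O\left(\frac{n^4F_{n-k}+kn^2}{n^4F_{n-k}^3+k^4F_{n-k}}\right)\right\}}+F_n\sqrt[4]{O\left(\frac{n^6F_{n-1}^2+n^2}{n^8F_{n-1}^7+F_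{n-1}^3}+\frac{n^{10}F_{n-2}^3+n^4}{n^{14}F_{n-2}^9+F_{n-2}^2}+\sum_{k=3}^{n-1}\frac{k^3n^{12}F_{n-k}^3+k^9n^6}{n^{16}F_{n-k}^9+k^{16}F_{n-k}}\right)}.$$
   Context: Random shortest path metric: let $G=(V,E)$ be the complete undirected graph on $n$ vertices; each edge $e$ independently receives a weight $w(e)\sim\mathrm{Exp}(1)$ (exponential distribution with rate $1$), and $d(u,v)$ is the minimum total weight of a $u$-$v$ path in $G$. Facility location: vertex $i\in V=[n]$ has opening cost $f_i>0$, the costs are deterministic (independent of the edge weights) and numbered so that $f_1\le\dots\le f_n$. For nonempty $U\subseteq V$, $c(U)=\sum_{i\in U}f_i+\sum_{v\in V}\min_{u\in U}d(u,v)$, and $\mathsf{OPT}=\min_{\emptyset\ne U\subseteq V}c(U)$. In the definition of $\kappa$, $1/(i-1)$ for $i=1$ is interpreted as $+\infty$. $\mathsf{ALG}=c(\{1,\ldots,\kappa\})$. Asymptotic notation refers to $n\to\infty$, where the opening costs are allowed to depend on $n$. *)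

theory Defs
  imports "HOL-Probability.Probability" "HOL-Library.Landau_Symbols"
begin

definition edges :: "nat \<Rightarrow> nat set set" where
  "edges n = {{i, j} | i j. i \<in> {1..n} \<and> j \<in> {1..n} \<and> i \<noteq> j}"

definition rspm :: "nat \<Rightarrow> (nat set \<Rightarrow> real) measure" where
  "rspm n = PiM (edges n) (\<lambda>_. density lborel (exponential_density 1))"

definition paths :: "nat \<Rightarrow> nat \<Rightarrow> nat \<Rightarrow> nat list set" where
  "paths n u v = {xs. xs \<noteq> [] \<and> distinct xs \<and> set xs \<subseteq> {1..n} \<and> hd xs = u \<and> last xs = v}"

definition path_weight :: "(nat set \<Rightarrow> real) \<Rightarrow> nat list \<Rightarrow> real" where
  "path_weight w xs = sum_list (map w (map2 (\<lambda>a b. {a, b}) xs (tl xs)))"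

definition dist_sp :: "nat \<Rightarrow> (nat set \<Rightarrow> real) \<Rightarrow> nat \<Rightarrow> nat \<Rightarrow> real" where
  "dist_sp n w u v = Min (path_weight w ` paths n u v)"

definition flcost :: "nat \<Rightarrow> (nat \<Rightarrow> real) \<Rightarrow> (nat set \<Rightarrow> real) \<Rightarrow> nat set \<Rightarrow> real" where
  "flcost n f w U = (\<Sum>i\<in>U. f i) + (\<Sum>v\<in>{1..n}. Min ((\<lambda>u. dist_sp n w u v) ` U))"

definition OPT :: "nat \<Rightarrow> (nat \<Rightarrow> real) \<Rightarrow> (nat set \<Rightarrow> real) \<Rightarrow> real" where
  "OPT n f w = Min (flcost n f w ` {U. U \<subseteq> {1..n} \<and> U \<noteq> {}})"

text \<open>kappa = max{i in [n] : f_i < 1/(i-1)}, with 1/(1-1) read as +infinity.\<close>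
definition kappa :: "nat \<Rightarrow> (nat \<Rightarrow> real) \<Rightarrow> nat" where
  "kappa n f = Max {i \<in> {1..n}. i = 1 \<or> f i < 1 / (real i - 1)}"

definition ALG :: "nat \<Rightarrow> (nat \<Rightarrow> real) \<Rightarrow> (nat set \<Rightarrow> real) \<Rightarrow> real" where
  "ALG n f w = flcost n f w {1..kappa n f}"

definition Fsum :: "(nat \<Rightarrow> real) \<Rightarrow> nat \<Rightarrow> real" where
  "Fsum f k = (\<Sum>i=1..k. f i)"

definition gterm :: "nat \<Rightarrow> (nat \<Rightarrow> real) \<Rightarrow> nat \<Rightarrow> real" where
  "gterm n f k = (let F = Fsum f (n - k); N = real n; K = real k in
     (N^4 * F + K * N^2) / (N^4 * F^3 + K^4 * F))"

definition hterm :: "nat \<Rightarrow> (nat \<Rightarrow> real) \<Rightarrow> real" where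
  "hterm n f = (let N = real n; F1 = Fsum f (n - 1); F2 = Fsum f (n - 2) in
     (N^6 * F1^2 + N^2) / (N^8 * F1^7 + F1^3)
   + (N^10 * F2^3 + N^4) / (N^14 * F2^9 + F2^2)
   + (\<Sum>k=3..n-1. let F = Fsum f (n - k); K = real k in
        (K^3 * N^12 * F^3 + K^9 * N^6) / (N^16 * F^9 + K^16 * F)))"

text \<open>The bound with hidden O-constant C.\<close>
definition bound :: "real \<Rightarrow> nat \<Rightarrow> (nat \<Rightarrow> real) \<Rightarrow> real" where
  "bound C n f = sqrt (Max (insert (1 / (Fsum f n)^2) ((\<lambda>k. C * gterm n f k) ` {1..n-1})))
     + root 4 (C * hterm n f)"

end

theory Submission
  imports Defs
begin

text \<open>
  Let \<open>U\<close> be an optimal set with \<open>k\<close> closed facilities. The last edges of the shortest paths from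
  \<open>U\<close> to the closed vertices are \<open>k\<close> distinct edges, so \<open>OPT\<close> is at least \<open>F\<^bsub>n-k\<^esub>\<close> plus the weight of
  some \<open>k\<close>-set of edges. Such a sum of weights is typically at least of order \<open>k\<^sup>2 / n\<^sup>2\<close>, and if
  \<open>F\<^bsub>n-k\<^esub>\<close> or the edge sum is at least of this order then \<open>1 / OPT\<^sup>2\<close> is at most a constant times the
  first (\<open>max\<close>) term of the bound. In the remaining event \<open>1 / OPT\<^sup>4\<close> is summed over all \<open>k\<close>-sets of
  edges; a union bound with the Erlang density shows that the expectation of this sum is
  at most a constant times the argument of the fourth root. Only the case \<open>k = 0\<close> contributes
  \<open>1 / F\<^sub>n\<close>, with constant 1. Finally \<open>ALG\<close> has bounded second moment because the distance of a
  vertex to \<open>{1..\<kappa>}\<close> is at most a minimum of \<open>\<kappa> = \<Theta>(n)\<close> exponential variables.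
\<close>

section \<open>Shortest paths and facility costs\<close>

lemma path_weight_snoc:
  "xs \<noteq> [] \<Longrightarrow> path_weight w (xs @ [v]) = path_weight w xs + w {last xs, v}"
proof (induction xs)
  case (Cons a xs)
  then show ?case by (cases xs) (auto simp: path_weight_def)
qed simp

lemma edges_iff: "{u, v} \<in> edges n \<longleftrightarrow> u \<in> {1..n} \<and> v \<in> {1..n} \<and> u \<noteq> v"
  unfolding edges_def by (auto simp: doubleton_eq_iff)

lemma finite_edges: "finite (edges n)"
  and card_edges_le: "card (edges n) \<le> n\<^sup>2"
proof -
  have sub: "edges n \<subseteq> (\<lambda>(i, j). {i, j}) ` ({1..n} \<times> {1..n})"
    unfolding edges_def by auto
  then show "finite (edges n)" by (rule finite_subset) simp
  have "card (edges n) \<le> card ((\<lambda>(i, j). {i, j}) ` ({1..n} \<times> {1..n}))"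
    using sub by (rule card_mono[rotated]) simp
  also have "\<dots> \<le> card ({1..n} \<times> {1..n})" by (rule card_image_le) simp
  finally show "card (edges n) \<le> n\<^sup>2" by (simp add: power2_eq_square)
qed

lemma path_weight_nonneg:
  assumes "\<And>e. e \<in> edges n \<Longrightarrow> 0 \<le> w e" "distinct xs" "set xs \<subseteq> {1..n}"
  shows "0 \<le> path_weight w xs"
  using assms(2,3)
proof (induction xs rule: rev_induct)
  case Nil
  then show ?case by (simp add: path_weight_def)
next
  case (snoc v xs)
  show ?case
  proof (cases "xs = []")
    case True
    then show ?thesis by (simp add: path_weight_def)
  next
    case False
    then have "last xs \<in> set xs" by simp
    with snoc.prems have "{last xs, v} \<in> edges n" by (auto simp: edges_iff)
    with snoc False show ?thesis by (auto simp: path_weight_snoc assms(1))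
  qed
qed

lemma finite_paths: "finite (paths n u v)"
  unfolding paths_def
  by (rule finite_subset[OF _ finite_subset_distinct[of "{1..n}"]]) auto

lemma paths_nonempty: "u \<in> {1..n} \<Longrightarrow> v \<in> {1..n} \<Longrightarrow> paths n u v \<noteq> {}"
proof (cases "u = v")
  case True
  assume "u \<in> {1..n}"
  with True have "[u] \<in> paths n u v" by (simp add: paths_def)
  then show ?thesis by blast
next
  case False
  assume "u \<in> {1..n}" "v \<in> {1..n}"
  with False have "[u, v] \<in> paths n u v" by (simp add: paths_def)
  then show ?thesis by blast
qed

lemma dist_sp_le: "xs \<in> paths n u v \<Longrightarrow> dist_sp n w u v \<le> path_weight w xs"
  unfolding dist_sp_def by (rule Min_le) (auto simp: finite_paths)

lemma dist_sp_attained: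
  assumes "u \<in> {1..n}" "v \<in> {1..n}"
  obtains xs where "xs \<in> paths n u v" "dist_sp n w u v = path_weight w xs"
proof -
  have "dist_sp n w u v \<in> path_weight w ` paths n u v"
    unfolding dist_sp_def using finite_paths paths_nonempty[OF assms] by (intro Min_in) auto
  then show ?thesis using that by auto
qed

lemma dist_sp_nonneg:
  assumes "\<And>e. e \<in> edges n \<Longrightarrow> 0 \<le> w e" "u \<in> {1..n}" "v \<in> {1..n}"
  shows "0 \<le> dist_sp n w u v"
proof -
  obtain xs where "xs \<in> paths n u v" "dist_sp n w u v = path_weight w xs"
    using dist_sp_attained assms(2,3) by blast
  then show ?thesis
    using path_weight_nonneg[of n w xs] assms(1) by (simp add: paths_def)
qed

lemma dist_sp_self: "v \<in> {1..n} \<Longrightarrow> dist_sp n w v v \<le> 0"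
  using dist_sp_le[of "[v]" n v v w] by (simp add: paths_def path_weight_def)

lemma dist_sp_le_edge:
  "u \<in> {1..n} \<Longrightarrow> v \<in> {1..n} \<Longrightarrow> u \<noteq> v \<Longrightarrow> dist_sp n w u v \<le> w {u, v}"
  using dist_sp_le[of "[u, v]" n u v w] by (simp add: paths_def path_weight_def)

section \<open>Connection costs, forests of last edges, and the lower bound on the optimum\<close>

definition conn :: "nat \<Rightarrow> (nat set \<Rightarrow> real) \<Rightarrow> nat set \<Rightarrow> nat \<Rightarrow> real" where
  "conn n w U v = Min ((\<lambda>u. dist_sp n w u v) ` U)"

lemma conn_le: "finite U \<Longrightarrow> u \<in> U \<Longrightarrow> conn n w U v \<le> dist_sp n w u v"
  unfolding conn_def by (rule Min_le) auto

lemma conn_attained: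
  assumes "finite U" "U \<noteq> {}"
  obtains u where "u \<in> U" "conn n w U v = dist_sp n w u v"
proof -
  have "conn n w U v \<in> (\<lambda>u. dist_sp n w u v) ` U"
    unfolding conn_def using assms by (intro Min_in) auto
  then show ?thesis using that by auto
qed

text \<open>Cut the last vertex off a shortest path from the nearest facility: what remains is a
  path from that facility to the penultimate vertex \<open>p\<close>, so it weighs at least the
  connection cost of \<open>p\<close>. The vertex \<open>p\<close> may be open or closed.\<close>

lemma conn_predecessor:
  assumes U: "U \<subseteq> {1..n}" "U \<noteq> {}" and v: "v \<in> {1..n} - U"
  shows "\<exists>p. {p, v} \<in> edges n \<and> conn n w U p + w {p, v} \<le> conn n w U v"
proof -
  have fin: "finite U" using U finite_subset by blast
  obtain u where u: "u \<in> U" "conn n w U v = dist_sp n w u v"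
    using conn_attained[OF fin U(2)] .
  obtain xs where xs: "xs \<in> paths n u v" "dist_sp n w u v = path_weight w xs"
    using dist_sp_attained[of u n v w] u U v by blast
  have [simp]: "xs \<noteq> []" using xs by (auto simp: paths_def)
  define ys where "ys = butlast xs"
  have eq: "xs = ys @ [v]"
    using xs unfolding ys_def by (auto simp: paths_def)
  \<comment> \<open>Since \<open>u\<close> is open and \<open>v\<close> is closed, the path has at
    least two vertices, so a last edge exists.\<close>
  have ne: "ys \<noteq> []"
    using xs u v unfolding eq by (auto simp: paths_def)
  have ys: "ys \<in> paths n u (last ys)"
    using xs ne unfolding eq by (auto simp: paths_def)
  have "set ys \<subseteq> {1..n}" "v \<notin> set ys"
    using xs unfolding eq by (auto simp: paths_def)
  then have "{last ys, v} \<in> edges n"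
    unfolding edges_iff using v last_in_set[OF ne] by blast
  moreover have "conn n w U (last ys) + w {last ys, v} \<le> path_weight w ys + w {last ys, v}"
    using conn_le[OF fin u(1), of n w "last ys"] dist_sp_le[OF ys, of w] by linarith
  ultimately show ?thesis
    using u xs ne by (auto simp: eq path_weight_snoc)
qed

lemma conn_nonneg:
  assumes "U \<subseteq> {1..n}" "U \<noteq> {}" "\<And>e. e \<in> edges n \<Longrightarrow> 0 \<le> w e" "v \<in> {1..n}"
  shows "0 \<le> conn n w U v"
proof -
  have "finite U" using assms(1) finite_subset by blast
  then obtain u where "u \<in> U" "conn n w U v = dist_sp n w u v"
    using conn_attained assms(2) by blast
  then show ?thesis using dist_sp_nonneg[of n w u v] assms by auto
qed

text \<open>Along a shortest path every closed vertex is strictly farther from \<^term>\<open>U\<close> than its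
  predecessor, so no edge is the predecessor edge of both of its endpoints.\<close>

lemma connection_cost_ge_forest:
  assumes U: "U \<subseteq> {1..n}" "U \<noteq> {}" and w: "\<And>e. e \<in> edges n \<Longrightarrow> 0 < w e"
  shows "\<exists>E\<subseteq>edges n. card E = n - card U \<and> sum w E \<le> (\<Sum>v\<in>{1..n}. conn n w U v)"
proof -
  have fin: "finite U" using U finite_subset by blast
  have nn: "0 \<le> conn n w U v" if "v \<in> {1..n}" for v
    using conn_nonneg[OF U, of w v] w that by (force intro: less_imp_le)
  obtain p where p: "\<And>v. v \<in> {1..n} - U \<Longrightarrow>
      {p v, v} \<in> edges n \<and> conn n w U (p v) + w {p v, v} \<le> conn n w U v"
    using conn_predecessor[OF U, of _ w] by metis
  let ?e = "\<lambda>v. {p v, v}"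
  have less: "conn n w U (p v) < conn n w U v" if "v \<in> {1..n} - U" for v
    using p[OF that] w[of "{p v, v}"] by linarith
  have inj: "inj_on ?e ({1..n} - U)"
  proof (rule inj_onI, rule ccontr)
    fix v v' assume v: "v \<in> {1..n} - U" "v' \<in> {1..n} - U" "?e v = ?e v'" "v \<noteq> v'"
    then have "p v = v'" "p v' = v" by (auto simp: doubleton_eq_iff)
    with less[OF v(1)] less[OF v(2)] show False by simp
  qed
  have "sum w (?e ` ({1..n} - U)) = (\<Sum>v\<in>{1..n} - U. w (?e v))"
    using inj by (simp add: sum.reindex)
  also have "\<dots> \<le> (\<Sum>v\<in>{1..n} - U. conn n w U v)"
  proof (rule sum_mono)
    fix v assume v: "v \<in> {1..n} - U"
    have "0 \<le> conn n w U (p v)" using p[OF v] by (intro nn) (simp add: edges_iff)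
    with p[OF v] show "w (?e v) \<le> conn n w U v" by linarith
  qed
  also have "\<dots> \<le> (\<Sum>v\<in>{1..n}. conn n w U v)"
    by (rule sum_mono2) (auto intro: nn)
  finally show ?thesis
    using p inj U fin
    by (intro exI[of _ "?e ` ({1..n} - U)"]) (auto simp: card_image card_Diff_subset)
qed

text \<open>If \<open>Suc n\<close> lies in \<open>U\<close>, the rest of \<open>U\<close> has at
  most \<open>n\<close> members, so by monotonicity \<open>Suc n\<close> costs at least as much as
  the facility numbered \<open>card U\<close>; the induction hypothesis treats the rest.\<close>

lemma Fsum_card_le_sum:
  assumes "U \<subseteq> {1..n}" "\<And>i j. 1 \<le> i \<Longrightarrow> i \<le> j \<Longrightarrow> j \<le> n \<Longrightarrow> f i \<le> f j"
  shows "Fsum f (card U) \<le> sum f U"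
  using assms
proof (induction n arbitrary: U)
  case 0
  then show ?case by (simp add: Fsum_def)
next
  case (Suc n)
  have fin: "finite U" using Suc.prems finite_subset by blast
  show ?case
  proof (cases "Suc n \<in> U")
    case False
    then have "U \<subseteq> {1..n}" using Suc.prems(1) by (force simp: atLeastAtMostSuc_conv)
    then show ?thesis using Suc.IH[of U] Suc.prems(2) by simp
  next
    case True
    define V where "V = U - {Suc n}"
    have V: "V \<subseteq> {1..n}" using Suc.prems(1) by (force simp: V_def atLeastAtMostSuc_conv)
    have card: "card U = Suc (card V)"
      unfolding V_def using card.remove[OF fin True] .
    have "card V \<le> n" using card_mono[OF _ V] by simp
    then have "f (Suc (card V)) \<le> f (Suc n)" by (intro Suc.prems(2)) auto
    moreover have "Fsum f (card V) \<le> sum f V" using Suc.IH[OF V] Suc.prems(2) by simp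
    moreover have "sum f U = f (Suc n) + sum f V"
      unfolding V_def using sum.remove[OF fin True] .
    ultimately show ?thesis by (simp add: card Fsum_def)
  qed
qed

text \<open>The optimal set is forgotten; only the number \<open>k\<close> of closed facilities and
  a \<open>k\<close>-set of edges survive, which suits a union bound over edge sets. The case
  \<open>k = 0\<close> stays apart because it must yield \<open>1 / Fsum f n\<close> with constant
  1.\<close>

lemma OPT_lower_bound:
  assumes n: "1 \<le> n" and w: "\<And>e. e \<in> edges n \<Longrightarrow> 0 < w e"
    and mono: "\<And>i j. 1 \<le> i \<Longrightarrow> i \<le> j \<Longrightarrow> j \<le> n \<Longrightarrow> f i \<le> f j"
  shows "Fsum f n \<le> OPT n f w \<or>
    (\<exists>k\<in>{1..n-1}. \<exists>E\<subseteq>edges n. card E = k \<and> Fsum f (n - k) + sum w E \<le> OPT n f w)"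
proof -
  have "OPT n f w \<in> flcost n f w ` {U. U \<subseteq> {1..n} \<and> U \<noteq> {}}"
    unfolding OPT_def using n by (intro Min_in) auto
  then obtain U where U: "U \<subseteq> {1..n}" "U \<noteq> {}" and opt: "OPT n f w = flcost n f w U"
    by blast
  obtain E where E: "E \<subseteq> edges n" "card E = n - card U"
      "sum w E \<le> (\<Sum>v\<in>{1..n}. conn n w U v)"
    using connection_cost_ge_forest[OF U, of w] w by metis
  have le: "Fsum f (card U) + sum w E \<le> OPT n f w"
    using Fsum_card_le_sum[of U n f] U(1) mono E(3) unfolding opt flcost_def conn_def by simp
  have c: "card U \<le> n" "card U \<noteq> 0"
    using card_mono[OF _ U(1)] U finite_subset[OF U(1)] by auto
  show ?thesis
  proof (cases "card U = n")
    case True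
    have "0 \<le> sum w E" using E(1) w by (intro sum_nonneg) (auto intro: less_imp_le)
    with le True show ?thesis by simp
  next
    case False
    with c le E show ?thesis
      by (intro disjI2 bexI[of _ "n - card U"] exI[of _ E]) auto
  qed
qed

section \<open>Upper bound on the cost of opening a prefix\<close>

text \<open>Direct edges from \<open>v\<close> to the open facilities \<open>{1..m}\<close>, used
  for \<open>m < v\<close>, where no loop occurs.\<close>

definition star :: "nat \<Rightarrow> nat \<Rightarrow> nat set set" where
  "star m v = (\<lambda>u. {u, v}) ` {1..m}"

lemma card_star: "card (star m v) = m"
  unfolding star_def by (subst card_image) (auto simp: inj_on_def doubleton_eq_iff)

lemma star_subset_edges: "v \<in> {m<..n} \<Longrightarrow> star m v \<subseteq> edges n"
  unfolding star_def by (auto simp: edges_iff)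

text \<open>Vertices up to \<open>m\<close> are open and connect at cost at most zero; each later
  vertex connects no worse than by its cheapest direct edge to the prefix.\<close>

lemma flcost_prefix_le:
  assumes "1 \<le> m" "m \<le> n"
  shows "flcost n f w {1..m} \<le> Fsum f m + (\<Sum>v\<in>{m<..n}. Min (w ` star m v))"
proof -
  have "(\<Sum>v\<in>{1..n}. conn n w {1..m} v)
      \<le> (\<Sum>v\<in>{1..n}. if m < v then Min (w ` star m v) else 0)"
  proof (rule sum_mono)
    fix v assume v: "v \<in> {1..n}"
    show "conn n w {1..m} v \<le> (if m < v then Min (w ` star m v) else 0)"
    proof (cases "m < v")
      case True
      have "conn n w {1..m} v \<le> w e" if e: "e \<in> star m v" for e
      proof -
        obtain u where u: "u \<in> {1..m}" "e = {u, v}" using e by (auto simp: star_def)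
        then show ?thesis
          using conn_le[of "{1..m}" u n w v] dist_sp_le_edge[of u n v w] True v assms by simp
      qed
      then show ?thesis using True assms by (auto simp: star_def)
    next
      case False
      then show ?thesis
        using conn_le[of "{1..m}" v n w v] dist_sp_self[of v n w] v by simp
    qed
  qed
  also have "\<dots> = (\<Sum>v\<in>{m<..n}. Min (w ` star m v))"
    by (rule sum.mono_neutral_cong_right) auto
  finally show ?thesis by (simp add: flcost_def conn_def Fsum_def)
qed

section \<open>Moments of the edge weights\<close>

lemma prob_space_rspm: "prob_space (rspm n)"
  unfolding rspm_def by (intro prob_space_PiM prob_space_exponential_density) simp

lemma measurable_weight:
  "e \<in> edges n \<Longrightarrow> (\<lambda>w. w e) \<in> borel_measurable (rspm n)"
  using measurable_component_singleton[of e "edges n" "\<lambda>_. density lborel (exponential_density 1)"]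
  unfolding rspm_def by simp

lemma distributed_weight:
  assumes "e \<in> edges n"
  shows "distributed (rspm n) lborel (\<lambda>w. w e) (exponential_density 1)"
proof -
  let ?D = "density lborel (exponential_density 1)"
  have "distr (rspm n) lborel (\<lambda>w. w e) = distr (rspm n) ?D (\<lambda>w. w e)"
    by (rule distr_cong) simp_all
  also have "\<dots> = ?D"
    unfolding rspm_def using assms
    by (intro distr_PiM_component prob_space_exponential_density) simp_all
  finally show ?thesis
    using measurable_weight[OF assms] by (simp add: distributed_def)
qed

text \<open>Independence means that the joint law is the product of the marginals;
  \<open>rspm n\<close> is such a product, and the joint map is the identity on its space.\<close>

lemma indep_weights:
  assumes "E \<subseteq> edges n" "E \<noteq> {}"
  shows "prob_space.indep_vars (rspm n) (\<lambda>_. borel) (\<lambda>e w. w e) E"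
proof -
  interpret prob_space "rspm n" by (rule prob_space_rspm)
  let ?D = "density lborel (exponential_density 1)"
  have ne: "edges n \<noteq> {}" using assms by auto
  have "distr (rspm n) (\<Pi>\<^sub>M i\<in>edges n. borel) (\<lambda>w. \<lambda>e\<in>edges n. w e)
      = distr (rspm n) (rspm n) (\<lambda>w. w)"
  proof (rule distr_cong)
    show "sets (\<Pi>\<^sub>M i\<in>edges n. borel) = sets (rspm n)"
      unfolding rspm_def by (rule sets_PiM_cong) simp_all
    \<comment> \<open>Points of a product space are undefined outside \<open>edges n\<close>, so
      restriction changes nothing.\<close>
    show "(\<lambda>e\<in>edges n. w e) = w" if "w \<in> space (rspm n)" for w
      using that unfolding rspm_def by (auto simp: space_PiM PiE_def extensional_restrict)
  qed simp
  also have "\<dots> = (\<Pi>\<^sub>M e\<in>edges n. distr (rspm n) borel (\<lambda>w. w e))"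
    unfolding distr_id
  proof (subst rspm_def, rule PiM_cong)
    fix e assume "e \<in> edges n"
    then have "distr (rspm n) lborel (\<lambda>w. w e) = ?D"
      using distributed_weight by (simp add: distributed_def)
    moreover have "distr (rspm n) lborel (\<lambda>w. w e) = distr (rspm n) borel (\<lambda>w. w e)"
      by (rule distr_cong) simp_all
    ultimately show "?D = distr (rspm n) borel (\<lambda>w. w e)" by simp
  qed simp
  finally have "indep_vars (\<lambda>_. borel) (\<lambda>e w. w e) (edges n)"
    using indep_vars_iff_distr_eq_PiM'[OF ne, where M' = "\<lambda>_. borel" and X = "\<lambda>e w. w e"]
      measurable_weight by blast
  then show ?thesis using assms(1) by (rule indep_vars_subset)
qed

lemma AE_weights_pos: "AE w in rspm n. \<forall>e\<in>edges n. 0 < w e"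
proof (rule AE_finite_allI[OF finite_edges])
  fix e assume e: "e \<in> edges n"
  \<comment> \<open>The density is positive at 0 too, so positivity of the density only gives
    nonnegativity of \<open>x\<close>; the point 0 is discarded as a Lebesgue null set.\<close>
  have "AE x in lborel. 0 < exponential_density 1 x \<longrightarrow> 0 < (x::real)"
    using AE_lborel_singleton[of 0] by eventually_elim (auto simp: exponential_density_def)
  then have "AE x in density lborel (exponential_density 1). 0 < (x::real)"
    by (subst AE_density) auto
  then show "AE w in rspm n. 0 < w e"
    unfolding rspm_def using e
    by (intro AE_PiM_component prob_space_exponential_density) simp_all
qed

section \<open>Moment bounds for edge sums and for minima over stars\<close>

text \<open>The antiderivative is \<open>- 1 / (p * (F + t) ^ p)\<close>, which vanishes at infinity
  as \<open>1 \<le> p\<close>.\<close>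

lemma nn_integral_shifted_power:
  fixes F :: real
  assumes F: "0 < F" and p: "1 \<le> p"
  shows "(\<integral>\<^sup>+t. ennreal (1 / (F + t) ^ Suc p) * indicator {0..} t \<partial>lborel)
    = ennreal (1 / (real p * F ^ p))"
proof -
  have lim: "((\<lambda>t. - (1 / real p) * (inverse (F + t)) ^ p) \<longlongrightarrow> - (1 / real p) * 0 ^ p) at_top"
    by (intro tendsto_intros tendsto_inverse_0_at_top filterlim_tendsto_add_at_top[OF tendsto_const]
        filterlim_ident)
  have D: "((\<lambda>t. - (1 / real p) * (inverse (F + t)) ^ p) has_field_derivative
      1 / (F + t) ^ Suc p) (at t)" if "0 \<le> t" for t
  proof -
    let ?i = "inverse (F + t)"
    have "F + t \<noteq> 0" using that F by linarith
    then have "((\<lambda>t. - (1 / real p) * (inverse (F + t)) ^ p) has_field_derivative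
        - (1 / real p) * (real p * ?i ^ (p - 1) * - (?i * 1 * ?i))) (at t)"
      by (intro DERIV_cmult DERIV_power[THEN DERIV_cong] DERIV_inverse'[THEN DERIV_cong])
         (auto intro!: derivative_eq_intros)
    also have "- (1 / real p) * (real p * ?i ^ (p - 1) * - (?i * 1 * ?i)) = ?i ^ Suc p"
      using p by (cases p) auto
    finally show ?thesis by (simp add: power_inverse divide_inverse)
  qed
  have "(\<integral>\<^sup>+t. ennreal (1 / (F + t) ^ Suc p) * indicator {0..} t \<partial>lborel)
      = ennreal (- (1 / real p) * 0 ^ p - (- (1 / real p) * (inverse (F + 0)) ^ p))"
    using F by (intro nn_integral_FTC_atLeast D lim) auto
  moreover have "(0::real) ^ p = 0" using p by simp
  ultimately show ?thesis by (simp add: power_one_over inverse_eq_divide)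
qed

text \<open>The Erlang density of a sum of \<^term>\<open>k\<close> weights is at most \<open>t\<^bsup>k-1\<^esup> / (k-1)!\<close>;
  the free parameter \<^term>\<open>m\<close> says how many powers of \<^term>\<open>t\<close> are spent on cancelling
  \<open>(F + t)\<^sup>-\<^sup>4\<close>, the remaining ones being bounded by powers of \<^term>\<open>s\<close>.\<close>

lemma nn_integral_small_edge_sum:
  fixes F s :: real
  assumes E: "E \<subseteq> edges n" "card E = k" and F: "0 < F" and s: "0 \<le> s"
    and m: "1 \<le> m" "m \<le> k" "m \<le> 3"
  shows "(\<integral>\<^sup>+w. ennreal (if sum w E < s then 1 / (F + sum w E) ^ 4 else 0) \<partial>rspm n)
    \<le> ennreal (s ^ (k - m) / (fact (k - 1) * F ^ (4 - m)))"
proof -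
  interpret prob_space "rspm n" by (rule prob_space_rspm)
  have ne: "E \<noteq> {}" using E m by auto
  have fin: "finite E" using E finite_edges finite_subset by blast
  have D: "distributed (rspm n) lborel (\<lambda>w. \<Sum>e\<in>E. w e) (erlang_density (k - 1) 1)"
    using exponential_distributed_sum[OF fin ne zero_less_one _ indep_weights[OF E(1) ne]]
      distributed_weight E by blast
  let ?g = "\<lambda>t::real. ennreal (if t < s then 1 / (F + t) ^ 4 else 0)"
  have "(\<integral>\<^sup>+w. ?g (sum w E) \<partial>rspm n)
      = (\<integral>\<^sup>+t. ennreal (erlang_density (k - 1) 1 t) * ?g t \<partial>lborel)"
    by (rule distributed_nn_integral[OF D, symmetric]) measurable
  also have "\<dots> \<le> (\<integral>\<^sup>+t. ennreal (s ^ (k - m) / fact (k - 1)) *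
      (ennreal (1 / (F + t) ^ Suc (4 - m)) * indicator {0..} t) \<partial>lborel)"
  proof (rule nn_integral_mono)
    fix t :: real
    show "ennreal (erlang_density (k - 1) 1 t) * ?g t \<le> ennreal (s ^ (k - m) / fact (k - 1)) *
        (ennreal (1 / (F + t) ^ Suc (4 - m)) * indicator {0..} t)"
    proof (cases "0 \<le> t \<and> t < s")
      case True
      \<comment> \<open>Of the powers of \<open>t\<close>, \<open>m - 1\<close> go into
        \<open>(F + t) ^ (m - 1)\<close> and the other \<open>k - m\<close> into
        \<open>s ^ (k - m)\<close>. The exponent left for \<open>1 / (F + t)\<close> is
        \<open>5 - m\<close>, at least 2, so the integral converges.\<close>
      have "t ^ (k - 1) = t ^ (k - m) * t ^ (m - 1)"
        using m by (simp flip: power_add)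
      also have "\<dots> \<le> s ^ (k - m) * (F + t) ^ (m - 1)"
        using True F by (intro mult_mono power_mono) auto
      finally have le: "t ^ (k - 1) * exp (- t) \<le> s ^ (k - m) * (F + t) ^ (m - 1)"
        using True s F by (smt (verit) exp_le_one_iff exp_gt_zero mult_left_le zero_le_power)
      have pw: "(F + t) ^ 4 = (F + t) ^ (m - 1) * (F + t) ^ Suc (4 - m)"
        using m by (simp flip: power_add power_Suc)
      have pos: "0 < F + t" using True F by linarith
      have "erlang_density (k - 1) 1 t * (1 / (F + t) ^ 4)
          = t ^ (k - 1) * exp (- t) / (fact (k - 1) * (F + t) ^ 4)"
        using True by (simp add: erlang_density_def)
      also have "\<dots> \<le> s ^ (k - m) * (F + t) ^ (m - 1) / (fact (k - 1) * (F + t) ^ 4)"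
        using le pos by (intro divide_right_mono) auto
      also have "\<dots> = s ^ (k - m) / fact (k - 1) * (1 / (F + t) ^ Suc (4 - m))"
        unfolding pw using pos by (simp del: power_Suc)
      finally show ?thesis
        using True pos s by (simp add: ennreal_mult[symmetric] ennreal_leI del: power_Suc)
    next
      case False
      then show ?thesis by (auto simp: erlang_density_def)
    qed
  qed
  also have "\<dots> = ennreal (s ^ (k - m) / fact (k - 1)) * ennreal (1 / (real (4 - m) * F ^ (4 - m)))"
    using F m by (subst nn_integral_cmult) (auto simp: nn_integral_shifted_power simp del: power_Suc)
  also have "\<dots> = ennreal (s ^ (k - m) / fact (k - 1) * (1 / (real (4 - m) * F ^ (4 - m))))"
    using s by (subst ennreal_mult'') (auto simp: F less_imp_le)
  \<comment> \<open>The factor \<open>1 / (4 - m)\<close> from the integral is at most 1 and is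
    dropped.\<close>
  also have "\<dots> \<le> ennreal (s ^ (k - m) / fact (k - 1) * (1 / F ^ (4 - m)))"
    using s F m by (intro ennreal_leI mult_left_mono frac_le) auto
  finally show ?thesis by simp
qed

lemma measurable_Min_star:
  assumes "1 \<le> m" "v \<in> {m<..n}"
  shows "(\<lambda>w. Min (w ` star m v)) \<in> borel_measurable (rspm n)"
  using star_subset_edges[OF assms(2)]
  by (intro borel_measurable_Min) (auto simp: star_def intro: measurable_weight)

text \<open>The minimum of \<open>m\<close> independent rate-1 exponentials is exponential with rate
  \<open>m\<close>; the rest is the moment formula.\<close>

lemma nn_integral_Min_star_squared:
  assumes m: "1 \<le> m" and v: "v \<in> {m<..n}"
  shows "(\<integral>\<^sup>+w. ennreal ((Min (w ` star m v))\<^sup>2) \<partial>rspm n) = ennreal (2 / (real m)\<^sup>2)"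
proof -
  interpret prob_space "rspm n" by (rule prob_space_rspm)
  have ne: "star m v \<noteq> {}" using m by (auto simp: star_def)
  have sub: "star m v \<subseteq> edges n" using v by (rule star_subset_edges)
  have D: "distributed (rspm n) lborel (\<lambda>w. Min ((\<lambda>e. w e) ` star m v))
      (exponential_density (\<Sum>e\<in>star m v. 1))"
    using finite_edges sub
    by (intro exponential_distributed_Min ne indep_weights distributed_weight)
       (auto intro: finite_subset)
  have "(\<integral>\<^sup>+w. ennreal ((Min (w ` star m v))\<^sup>2) \<partial>rspm n)
      = (\<integral>\<^sup>+t. ennreal (exponential_density (real m) t) * ennreal (t\<^sup>2) \<partial>lborel)"
    using D by (intro distributed_nn_integral[symmetric]) (simp_all add: card_star)
  also have "\<dots> = (\<integral>\<^sup>+t. ennreal (exponential_density (real m) t * t\<^sup>2) \<partial>lborel)"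
    using m by (simp add: ennreal_mult)
  also have "\<dots> = ennreal (2 / (real m)\<^sup>2)"
    using m by (subst nn_integral_erlang_ith_moment) (auto simp: fact_numeral)
  finally show ?thesis .
qed

text \<open>Cauchy-Schwarz over at most \<open>n\<close> vertices reduces the square of the sum to
  the single second moments \<open>2 / m^2\<close>. For \<open>m\<close> of order \<open>n\<close>
  and bounded \<open>c\<close> the result is a constant.\<close>

lemma nn_integral_prefix_cost_squared:
  assumes m: "1 \<le> m"
  shows "(\<integral>\<^sup>+w. ennreal ((c + (\<Sum>v\<in>{m<..n}. Min (w ` star m v)))\<^sup>2) \<partial>rspm n)
    \<le> ennreal (2 * c\<^sup>2 + 4 * (real n / real m)\<^sup>2)"
proof -
  interpret prob_space "rspm n" by (rule prob_space_rspm)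
  let ?m = "\<lambda>v w. Min (w ` star m v)"
  have "(c + (\<Sum>v\<in>{m<..n}. ?m v w))\<^sup>2 \<le> 2 * c\<^sup>2 + 2 * real n * (\<Sum>v\<in>{m<..n}. (?m v w)\<^sup>2)"
    for w :: "nat set \<Rightarrow> real"
  proof -
    let ?S = "\<Sum>v\<in>{m<..n}. ?m v w" and ?Q = "\<Sum>v\<in>{m<..n}. (?m v w)\<^sup>2"
    have "?S\<^sup>2 \<le> ?Q * real (card {m<..n})"
      by (rule sum_squared_le_sum_of_squares)
    also have "\<dots> \<le> ?Q * real n" by (intro mult_left_mono sum_nonneg) auto
    moreover have "(c + ?S)\<^sup>2 \<le> 2 * c\<^sup>2 + 2 * ?S\<^sup>2"
      using zero_le_power2[of "c - ?S"] by (simp add: power2_eq_square algebra_simps)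
    ultimately show ?thesis by (simp add: mult_ac)
  qed
  moreover have meas: "(\<lambda>w. ennreal ((?m v w)\<^sup>2)) \<in> borel_measurable (rspm n)"
    if "v \<in> {m<..n}" for v
    using measurable_Min_star[OF m that] by measurable
  ultimately have "(\<integral>\<^sup>+w. ennreal ((c + (\<Sum>v\<in>{m<..n}. ?m v w))\<^sup>2) \<partial>rspm n)
      \<le> (\<integral>\<^sup>+w. ennreal (2 * c\<^sup>2) + ennreal (2 * real n) * (\<Sum>v\<in>{m<..n}. ennreal ((?m v w)\<^sup>2)) \<partial>rspm n)"
    by (intro nn_integral_mono) (simp add: sum_nonneg flip: ennreal_plus ennreal_mult ennreal_leI)
  also have "\<dots> = ennreal (2 * c\<^sup>2) +
      ennreal (2 * real n) * (\<Sum>v\<in>{m<..n}. \<integral>\<^sup>+w. ennreal ((?m v w)\<^sup>2) \<partial>rspm n)"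
    using meas
    by (simp add: nn_integral_add nn_integral_cmult nn_integral_sum emeasure_space_1
        del: sum_ennreal greaterThanAtMost_iff)
  also have "\<dots> = ennreal (2 * c\<^sup>2) + ennreal (2 * real n) * (\<Sum>v\<in>{m<..n}. ennreal (2 / (real m)\<^sup>2))"
    using nn_integral_Min_star_squared[OF m] by (intro arg_cong2[where f="(+)"] arg_cong2[where f="(*)"] sum.cong) auto
  also have "\<dots> = ennreal (2 * c\<^sup>2 + 2 * real n * (real (n - m) * (2 / (real m)\<^sup>2)))"
    by (simp add: ennreal_of_nat_eq_real_of_nat flip: ennreal_plus ennreal_mult)
  also have "\<dots> \<le> ennreal (2 * c\<^sup>2 + 2 * real n * (real n * (2 / (real m)\<^sup>2)))"
    by (intro ennreal_leI add_left_mono mult_left_mono mult_right_mono) auto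
  finally show ?thesis by (simp add: power_divide power2_eq_square)
qed

section \<open>Comparison with the terms of the bound\<close>

lemma Fsum_pos:
  "1 \<le> j \<Longrightarrow> (\<And>i. 1 \<le> i \<Longrightarrow> i \<le> j \<Longrightarrow> 0 < f i) \<Longrightarrow> 0 < Fsum f j"
  unfolding Fsum_def by (rule sum_pos) auto

lemma gterm_nonneg: "0 \<le> Fsum f (n - k) \<Longrightarrow> 0 \<le> gterm n f k"
  unfolding gterm_def Let_def by (intro divide_nonneg_nonneg add_nonneg_nonneg mult_nonneg_nonneg) auto

text \<open>In this regime \<open>N^4 * F^3\<close> dominates the denominator, which is at most
  twice that; the summand \<open>N^4 * F\<close> of the numerator then suffices.\<close>

lemma gterm_ge_facility_cost:
  assumes F: "0 < Fsum f (n - k)" and n: "1 \<le> n"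
    and le: "(real k)\<^sup>2 \<le> (real n)\<^sup>2 * Fsum f (n - k)"
  shows "1 / (Fsum f (n - k))\<^sup>2 \<le> 2 * gterm n f k"
proof -
  define F N K where "F = Fsum f (n - k)" and "N = real n" and "K = real k"
  have pos: "0 < F" "0 < N" "0 \<le> K" using F n by (auto simp: F_def N_def K_def)
  have "(K\<^sup>2)\<^sup>2 \<le> (N\<^sup>2 * F)\<^sup>2" using le by (intro power_mono) (auto simp: F_def N_def K_def)
  then have "K ^ 4 \<le> N ^ 4 * F\<^sup>2" by (simp add: power_mult_distrib flip: power_mult)
  then have "K ^ 4 * F \<le> N ^ 4 * F\<^sup>2 * F" using pos by (intro mult_right_mono) auto
  then have "N ^ 4 * F ^ 3 + K ^ 4 * F \<le> 2 * (N ^ 4 * F) * F\<^sup>2"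
    by (simp add: power2_eq_square power3_eq_cube mult_ac)
  also have "\<dots> \<le> 2 * (N ^ 4 * F + K * N\<^sup>2) * F\<^sup>2"
    using pos by (intro mult_right_mono) auto
  finally have "N ^ 4 * F ^ 3 + K ^ 4 * F \<le> 2 * (N ^ 4 * F + K * N\<^sup>2) * F\<^sup>2" .
  moreover have "0 < N ^ 4 * F ^ 3 + K ^ 4 * F" using pos by (intro add_pos_nonneg) auto
  ultimately have "1 / F\<^sup>2 \<le> 2 * ((N ^ 4 * F + K * N\<^sup>2) / (N ^ 4 * F ^ 3 + K ^ 4 * F))"
    using pos by (simp add: field_simps)
  then show ?thesis by (simp add: gterm_def Let_def F_def N_def K_def)
qed

text \<open>The complementary regime: \<open>K^4 * F\<close> dominates the denominator, so the
  quotient is at least \<open>N^4 / (2 * K^4)\<close>. This is the order of \<open>1 / OPT^2\<close>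
  when the edges cost about \<open>k^2 / n^2\<close>.\<close>

lemma gterm_ge_edge_cost:
  assumes F: "0 < Fsum f (n - k)" and n: "1 \<le> n" "1 \<le> k"
    and less: "(real n)\<^sup>2 * Fsum f (n - k) < (real k)\<^sup>2"
  shows "((real n)\<^sup>2 / (real k)\<^sup>2)\<^sup>2 \<le> 2 * gterm n f k"
proof -
  define F N K where "F = Fsum f (n - k)" and "N = real n" and "K = real k"
  have pos: "0 < F" "0 < N" "0 < K" using F n by (auto simp: F_def N_def K_def)
  have "(N\<^sup>2 * F)\<^sup>2 \<le> (K\<^sup>2)\<^sup>2"
    using less pos by (intro power_mono) (auto simp: F_def N_def K_def)
  then have "N ^ 4 * F\<^sup>2 \<le> K ^ 4" by (simp add: power_mult_distrib flip: power_mult)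
  then have "N ^ 4 * F\<^sup>2 * (N ^ 4 * F) \<le> K ^ 4 * (N ^ 4 * F)"
    using pos by (intro mult_right_mono) auto
  then have "N ^ 4 * (N ^ 4 * F ^ 3 + K ^ 4 * F) \<le> 2 * (N ^ 4 * F) * K ^ 4"
    by (simp add: power2_eq_square power3_eq_cube algebra_simps)
  also have "\<dots> \<le> 2 * (N ^ 4 * F + K * N\<^sup>2) * K ^ 4"
    using pos by (intro mult_right_mono) auto
  finally have "N ^ 4 * (N ^ 4 * F ^ 3 + K ^ 4 * F) \<le> 2 * (N ^ 4 * F + K * N\<^sup>2) * K ^ 4" .
  moreover have "0 < N ^ 4 * F ^ 3 + K ^ 4 * F" using pos by (intro add_pos_nonneg) auto
  ultimately have "N ^ 4 / K ^ 4 \<le> 2 * ((N ^ 4 * F + K * N\<^sup>2) / (N ^ 4 * F ^ 3 + K ^ 4 * F))"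
    using pos by (simp add: field_simps)
  then show ?thesis
    by (simp add: gterm_def Let_def F_def N_def K_def power_divide flip: power_mult)
qed

section \<open>The summands of the fourth-root argument\<close>

text \<open>One formula for the three shapes of summand in \<open>hterm\<close>, so that
  \<open>hterm\<close> becomes a single sum over the number of closed facilities.\<close>

definition hpart :: "nat \<Rightarrow> (nat \<Rightarrow> real) \<Rightarrow> nat \<Rightarrow> real" where
  "hpart n f k = (let N = real n; K = real k; F = Fsum f (n - k) in
     if k = 1 then (N^6 * F^2 + N^2) / (N^8 * F^7 + F^3)
     else if k = 2 then (N^10 * F^3 + N^4) / (N^14 * F^9 + F^2)
     else (K^3 * N^12 * F^3 + K^9 * N^6) / (N^16 * F^9 + K^16 * F))"

lemma hpart_nonneg: "0 \<le> Fsum f (n - k) \<Longrightarrow> 0 \<le> hpart n f k"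
  unfolding hpart_def Let_def
  by (auto intro!: divide_nonneg_nonneg add_nonneg_nonneg mult_nonneg_nonneg)

lemma hterm_eq_sum:
  assumes "3 \<le> n" shows "hterm n f = (\<Sum>k=1..n-1. hpart n f k)"
proof -
  have "{1..n-1} = {1, 2} \<union> {3..n-1}" using assms by auto
  then have "(\<Sum>k=1..n-1. hpart n f k) = (\<Sum>k\<in>{1,2}. hpart n f k) + (\<Sum>k=3..n-1. hpart n f k)"
    by (simp add: sum.union_disjoint)
  moreover have "(\<Sum>k=3..n-1. hpart n f k) = (\<Sum>k=3..n-1. let F = Fsum f (n - k); K = real k in
        (K^3 * real n^12 * F^3 + K^9 * real n^6) / (real n^16 * F^9 + K^16 * F))"
    by (rule sum.cong) (auto simp: hpart_def Let_def)
  ultimately show ?thesis by (simp add: hterm_def hpart_def Let_def)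
qed

text \<open>Raising \<open>N^2 * F < K^2\<close> to the power 4, 7 or 8 shows that the second term
  of the denominator dominates up to a constant; of the numerator only the second term is kept. The
  left-hand sides are the shapes that the union bound in \<open>forest_moment_le_hpart\<close>
  produces.\<close>

lemma hpart_ge:
  assumes F: "0 < Fsum f (n - k)" and n: "1 \<le> n" "1 \<le> k"
    and less: "(real n)\<^sup>2 * Fsum f (n - k) < (real k)\<^sup>2"
  shows "k = 1 \<Longrightarrow> (real n)\<^sup>2 / Fsum f (n - k) ^ 3 \<le> 65536 * hpart n f k"
    and "k = 2 \<Longrightarrow> (real n) ^ 4 / (Fsum f (n - k))\<^sup>2 \<le> 65536 * hpart n f k"
    and "3 \<le> k \<Longrightarrow> (real n) ^ 6 / (real k ^ 7 * Fsum f (n - k)) \<le> 2 * hpart n f k"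
proof -
  define F N K where "F = Fsum f (n - k)" and "N = real n" and "K = real k"
  have pos: "0 < F" "0 < N" "0 < K" using F n by (auto simp: F_def N_def K_def)
  have pow: "(N\<^sup>2 * F) ^ j \<le> (K\<^sup>2) ^ j" for j
    using less pos by (intro power_mono) (auto simp: F_def N_def K_def)
  \<comment> \<open>Moves a constant \<open>c\<close> out of the denominator; \<open>c\<close> is 2
    for \<open>k = 1\<close> and \<open>4^7 + 1 = 16385\<close> for \<open>k = 2\<close>.\<close>
  have scale: "a / b \<le> 65536 * g" if le: "a / (c * b) \<le> g" and "0 \<le> g" "0 < c" "c \<le> 65536"
    for a b c g :: real
  proof -
    have "a / b = c * (a / (c * b))" using that by simp
    also have "\<dots> \<le> c * g" using that by (intro mult_left_mono) auto
    also have "\<dots> \<le> 65536 * g" using that by (intro mult_right_mono) auto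
    finally show ?thesis .
  qed
  {
    assume k: "k = 1"
    have "N ^ 8 * F ^ 4 \<le> 1" using pow[of 4] k by (simp add: K_def power_mult_distrib flip: power_mult)
    then have "N ^ 8 * F ^ 4 * F ^ 3 \<le> 1 * F ^ 3" using pos by (intro mult_right_mono) auto
    then have d: "N ^ 8 * F ^ 7 + F ^ 3 \<le> 2 * F ^ 3" by (simp add: mult.assoc flip: power_add)
    have "N\<^sup>2 / (2 * F ^ 3) \<le> (N^6 * F^2 + N^2) / (N^8 * F^7 + F^3)"
      using pos d by (intro frac_le add_nonneg_pos) auto
    moreover have "0 \<le> (N^6 * F^2 + N^2) / (N^8 * F^7 + F^3)" using pos by auto
    ultimately have "N\<^sup>2 / F ^ 3 \<le> 65536 * ((N^6 * F^2 + N^2) / (N^8 * F^7 + F^3))"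
      by (rule scale) auto
    then show "(real n)\<^sup>2 / Fsum f (n - k) ^ 3 \<le> 65536 * hpart n f k"
      using k by (simp add: hpart_def Let_def F_def N_def K_def)
  next
    assume k: "k = 2"
    have "N ^ 14 * F ^ 7 \<le> 16384" using pow[of 7] k by (simp add: K_def power_mult_distrib flip: power_mult)
    then have "N ^ 14 * F ^ 7 * F\<^sup>2 \<le> 16384 * F\<^sup>2" using pos by (intro mult_right_mono) auto
    then have d: "N ^ 14 * F ^ 9 + F\<^sup>2 \<le> 16385 * F\<^sup>2" by (simp add: mult.assoc flip: power_add)
    have "N ^ 4 / (16385 * F\<^sup>2) \<le> (N^10 * F^3 + N^4) / (N^14 * F^9 + F^2)"
      using pos d by (intro frac_le add_nonneg_pos) auto
    moreover have "0 \<le> (N^10 * F^3 + N^4) / (N^14 * F^9 + F^2)" using pos by auto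
    ultimately have "N ^ 4 / F\<^sup>2 \<le> 65536 * ((N^10 * F^3 + N^4) / (N^14 * F^9 + F^2))"
      by (rule scale) auto
    then show "(real n) ^ 4 / (Fsum f (n - k))\<^sup>2 \<le> 65536 * hpart n f k"
      using k by (simp add: hpart_def Let_def F_def N_def K_def)
  next
    assume k: "3 \<le> k"
    have "N ^ 16 * F ^ 8 \<le> K ^ 16" using pow[of 8] by (simp add: power_mult_distrib flip: power_mult)
    then have "N ^ 16 * F ^ 8 * F \<le> K ^ 16 * F" using pos by (intro mult_right_mono) auto
    then have "N ^ 16 * F ^ 9 \<le> K ^ 16 * F" by (simp add: mult.assoc flip: power_Suc2)
    then have d: "N ^ 16 * F ^ 9 + K ^ 16 * F \<le> 2 * (K ^ 16 * F)" by linarith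
    have "N ^ 6 / (K ^ 7 * F) = 2 * (K ^ 9 * N ^ 6 / (2 * (K ^ 16 * F)))"
      using pos by (simp add: divide_simps flip: power_add)
    also have "\<dots> \<le> 2 * ((K^3 * N^12 * F^3 + K^9 * N^6) / (N^16 * F^9 + K^16 * F))"
      using pos d by (intro mult_left_mono frac_le add_nonneg_pos) auto
    finally show "(real n) ^ 6 / (real k ^ 7 * Fsum f (n - k)) \<le> 2 * hpart n f k"
      using k by (simp add: hpart_def Let_def F_def N_def K_def)
  }
qed

section \<open>Factorial estimates and the union bound over edge sets\<close>

text \<open>\<open>k^k / k!\<close> is one term of the series for \<open>exp k\<close>, and
  \<open>exp 1 \<le> 3\<close>.\<close>

lemma power_self_le_fact: "real k ^ k \<le> 3 ^ k * fact k"
proof -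
  have "real k ^ k / fact k \<le> (\<Sum>n. real k ^ n /\<^sub>R fact n)"
    using sum_le_suminf[OF summable_exp_generic[of "real k"], of "{k}"]
    by (simp add: divide_inverse mult.commute)
  also have "\<dots> = exp (real k)" by (simp add: exp_def)
  also have "\<dots> = exp 1 ^ k" by (simp flip: exp_of_nat_mult)
  also have "\<dots> \<le> 3 ^ k" by (intro power_mono exp_le) simp
  finally show ?thesis by (simp add: field_simps)
qed

lemma square_le_power3: "(real k)\<^sup>2 \<le> 3 ^ k"
proof (induction k)
  case (Suc k)
  show ?case
  proof (cases "k \<le> 1")
    case True
    then show ?thesis by (cases k) auto
  next
    case False
    then have "2 * real k \<le> real k * real k" by (intro mult_right_mono) auto
    moreover have "2 \<le> real k" using False by simp
    ultimately have "1 + 2 * real k \<le> 2 * (real k * real k)" by linarith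
    then have "(real (Suc k))\<^sup>2 \<le> 3 * (real k)\<^sup>2"
      by (simp add: power2_eq_square algebra_simps)
    with Suc show ?thesis by simp
  qed
qed simp

text \<open>The estimates give base \<open>3^2 * 3 = 27\<close>, rounded up to 32, the constant in
  the threshold \<open>k^2 / (32 * n^2)\<close> on edge sums. The extra \<open>k^2\<close> on the
  left helps to provide the polynomial decay in \<open>k\<close> of the summands.\<close>

lemma power_le_fact_squared: "real k ^ (2 * k + 2) \<le> 32 ^ k * (fact k)\<^sup>2"
proof -
  have "real k ^ (2 * k + 2) = (real k ^ k)\<^sup>2 * (real k)\<^sup>2"
    by (simp add: power_add power_mult power2_eq_square power_mult_distrib)
  also have "\<dots> \<le> (3 ^ k * fact k)\<^sup>2 * 3 ^ k"
    by (intro mult_mono power_mono power_self_le_fact square_le_power3) auto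
  also have "\<dots> = (3 ^ 3) ^ k * (fact k)\<^sup>2"
    by (simp add: power2_eq_square flip: power_mult_distrib)
  also have "\<dots> \<le> 32 ^ k * (fact k)\<^sup>2" by (intro mult_right_mono power_mono) auto
  finally show ?thesis .
qed

lemma binomial_edges_le: "real (card (edges n) choose k) \<le> (real n)\<^sup>2 ^ k / fact k"
proof -
  have "(card (edges n) choose k) * fact k \<le> card (edges n) ^ k" by (rule binomial_fact_pow)
  also have "\<dots> \<le> (n\<^sup>2) ^ k" by (intro power_mono card_edges_le) simp
  finally have "real ((card (edges n) choose k) * fact k) \<le> real ((n\<^sup>2) ^ k)"
    by (simp only: of_nat_le_iff)
  then show ?thesis by (simp add: field_simps)
qed

text \<open>Union bound: the number of \<open>k\<close>-sets times the estimate of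
  \<open>nn_integral_small_edge_sum\<close>. Taking \<open>m = min k 3\<close> spends as many powers
  of \<open>t\<close> as allowed and leaves \<open>F^3\<close>, \<open>F^2\<close>, \<open>F\<close>
  in the denominator for \<open>k = 1\<close>, \<open>k = 2\<close>, \<open>k \<ge> 3\<close>, as in
  \<open>hpart_ge\<close>.\<close>

lemma forest_moment_le_hpart:
  assumes F: "0 < Fsum f (n - k)" and n: "1 \<le> n" "1 \<le> k"
    and less: "(real n)\<^sup>2 * Fsum f (n - k) < (real k)\<^sup>2"
  defines "s \<equiv> (real k)\<^sup>2 / (32 * (real n)\<^sup>2)" and "m \<equiv> min k 3"
  shows "real (card (edges n) choose k) *
      (s ^ (k - m) / (fact (k - 1) * Fsum f (n - k) ^ (4 - m))) \<le> 65536 * hpart n f k"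
proof -
  define F where "F = Fsum f (n - k)"
  have Fp: "0 < F" using F by (simp add: F_def)
  have s: "0 \<le> s" by (simp add: s_def)
  have "real (card (edges n) choose k) * (s ^ (k - m) / (fact (k - 1) * F ^ (4 - m)))
      \<le> (real n)\<^sup>2 ^ k / fact k * (s ^ (k - m) / (fact (k - 1) * F ^ (4 - m)))"
    using s Fp by (intro mult_right_mono binomial_edges_le) auto
  also have "\<dots> \<le> 65536 * hpart n f k"
  proof -
    consider "k = 1" | "k = 2" | "3 \<le> k" using n by linarith
    then show ?thesis
    proof cases
      case 1
      then show ?thesis using hpart_ge(1)[OF F n less] by (simp add: m_def F_def)
    next
      case 2
      have "(real n) ^ 4 / (2 * F\<^sup>2) \<le> (real n) ^ 4 / F\<^sup>2"
        using Fp by (intro divide_left_mono) auto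
      with 2 show ?thesis
        using hpart_ge(2)[OF F n less] by (simp add: m_def F_def flip: power_mult)
    next
      case 3
      define j where "j = k - 3"
      have k: "k = j + 3" using 3 by (simp add: j_def)
      have m: "m = 3" using 3 by (simp add: m_def)
      define N K where "N = real n" and "K = real k"
      have pos: "0 < N" "0 < K" using n by (auto simp: N_def K_def)
      have fk: "fact k = K * fact (k - 1)" using n by (simp add: fact_reduce K_def)
      define \<phi> :: real where "\<phi> = fact k"
      have \<phi>: "0 < \<phi>" by (simp add: \<phi>_def)
      have fk': "fact (k - 1) = \<phi> / K" using fk pos by (simp add: \<phi>_def)
      have sj: "s ^ j = K\<^sup>2 ^ j / (32 ^ j * N\<^sup>2 ^ j)"
        by (simp add: s_def N_def K_def power_divide power_mult_distrib)
      have "N\<^sup>2 ^ k / \<phi> * (s ^ j / (\<phi> / K * F ^ 1))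
          = N\<^sup>2 ^ (j + 3) * (K\<^sup>2 ^ j / (32 ^ j * N\<^sup>2 ^ j)) * K / (\<phi> * \<phi> * F)"
        unfolding sj by (simp add: k mult_ac)
      \<comment> \<open>The factor \<open>N^(2*j)\<close> of \<open>N^(2*k)\<close> cancels against
        the threshold and leaves \<open>N^6\<close>; one \<open>K\<close> comes from
        \<open>(k - 1)! = k! / K\<close>.\<close>
      also have "\<dots> = N ^ 6 * (K ^ (2 * j + 1) / (32 ^ j * \<phi>\<^sup>2)) / F"
      proof -
        have "N\<^sup>2 ^ (j + 3) = N ^ 6 * N\<^sup>2 ^ j"
          by (simp add: power_add mult.commute flip: power_mult)
        moreover have "K ^ (2 * j + 1) = K\<^sup>2 ^ j * K" by (simp add: power_mult)
        ultimately show ?thesis using pos \<phi> by (simp add: power2_eq_square mult_ac)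
      qed
      also have "\<dots> \<le> N ^ 6 * (32768 / K ^ 7) / F"
      proof -
        \<comment> \<open>\<open>K^(2*k+2)\<close> splits off exactly the \<open>K^7\<close> of
          \<open>hpart_ge\<close>, and \<open>32^k\<close> exceeds the \<open>32^j\<close> of the
          threshold by \<open>32^3 = 32768\<close>.\<close>
        have "2 * k + 2 = (2 * j + 1) + 7" by (simp add: k)
        then have "K ^ (2 * j + 1) * K ^ 7 \<le> 32 ^ k * \<phi>\<^sup>2"
          using power_le_fact_squared[of k] by (simp only: K_def \<phi>_def power_add)
        also have "(32::real) ^ k = 32768 * 32 ^ j" by (simp add: k power_add)
        finally have "K ^ (2 * j + 1) \<le> 32768 * (32 ^ j * \<phi>\<^sup>2) / K ^ 7"
          using pos by (subst pos_le_divide_eq) (auto simp only: zero_less_power mult.assoc)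
        then have "K ^ (2 * j + 1) \<le> 32768 / K ^ 7 * (32 ^ j * \<phi>\<^sup>2)" by (simp only: times_divide_eq_left)
        then have "K ^ (2 * j + 1) / (32 ^ j * \<phi>\<^sup>2) \<le> 32768 / K ^ 7"
          using \<phi> by (subst pos_divide_le_eq) auto
        then show ?thesis using pos Fp by (intro divide_right_mono mult_left_mono) auto
      qed
      also have "\<dots> = 32768 * (N ^ 6 / (K ^ 7 * F))" by simp
      also have "\<dots> \<le> 32768 * (2 * hpart n f k)"
        using hpart_ge(3)[OF F n less 3] by (intro mult_left_mono) (auto simp: N_def K_def F_def)
      finally show ?thesis unfolding fk' m j_def by (simp add: N_def \<phi>_def)
    qed
  qed
  finally show ?thesis by (simp add: F_def)
qed

section \<open>Expected approximation ratio\<close>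

text \<open>Majorant of \<open>1 / OPT^4\<close> on the event of an unusually cheap edge set.
  Summing over all edge sets covers the unknown one of the optimum; only those \<open>k\<close>
  occur for which the facility cost alone is too small.\<close>

definition sparse_forest_sum :: "nat \<Rightarrow> (nat \<Rightarrow> real) \<Rightarrow> (nat set \<Rightarrow> real) \<Rightarrow> real" where
  "sparse_forest_sum n f w =
    (\<Sum>k | k \<in> {1..n-1} \<and> (real n)\<^sup>2 * Fsum f (n - k) < (real k)\<^sup>2.
      \<Sum>E | E \<subseteq> edges n \<and> card E = k.
        if sum w E < (real k)\<^sup>2 / (32 * (real n)\<^sup>2) then 1 / (Fsum f (n - k) + sum w E) ^ 4 else 0)"

lemma sparse_forest_sum_nonneg: "0 \<le> sparse_forest_sum n f w"
  unfolding sparse_forest_sum_def by (intro sum_nonneg) simp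

lemma measurable_sum_weights:
  "E \<subseteq> edges n \<Longrightarrow> (\<lambda>w. sum w E) \<in> borel_measurable (rspm n)"
  by (intro borel_measurable_sum measurable_weight) auto

lemma measurable_sparse_forest_sum: "sparse_forest_sum n f \<in> borel_measurable (rspm n)"
  unfolding sparse_forest_sum_def
proof (intro borel_measurable_sum)
  fix k E assume "E \<in> {E. E \<subseteq> edges n \<and> card E = k}"
  then have [measurable]: "(\<lambda>w. sum w E) \<in> borel_measurable (rspm n)"
    by (intro measurable_sum_weights) simp
  show "(\<lambda>w. if sum w E < (real k)\<^sup>2 / (32 * (real n)\<^sup>2) then 1 / (Fsum f (n - k) + sum w E) ^ 4 else 0)
      \<in> borel_measurable (rspm n)"
    by measurable
qed

text \<open>Linearity gives a union bound for each \<open>k\<close> in the sum; the missing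
  \<open>k\<close> may be added because \<open>hpart\<close> is nonnegative.\<close>

lemma nn_integral_sparse_forest_sum_le:
  assumes n: "3 \<le> n" and pos: "\<And>i. 1 \<le> i \<Longrightarrow> i \<le> n \<Longrightarrow> 0 < f i"
  shows "(\<integral>\<^sup>+w. ennreal (sparse_forest_sum n f w) \<partial>rspm n) \<le> ennreal (65536 * hterm n f)"
proof -
  define A where "A = {k. k \<in> {1..n-1} \<and> (real n)\<^sup>2 * Fsum f (n - k) < (real k)\<^sup>2}"
  define B where "B = (\<lambda>k. {E. E \<subseteq> edges n \<and> card E = k})"
  define t where "t = (\<lambda>k E (w :: nat set \<Rightarrow> real). if sum w E < (real k)\<^sup>2 / (32 * (real n)\<^sup>2)
    then 1 / (Fsum f (n - k) + sum w E) ^ 4 else 0)"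
  have Z: "sparse_forest_sum n f w = (\<Sum>k\<in>A. \<Sum>E\<in>B k. t k E w)" for w
    by (simp add: sparse_forest_sum_def A_def B_def t_def)
  have t_nonneg: "0 \<le> t k E w" for k E w by (simp add: t_def)
  have Fpos: "0 < Fsum f (n - k)" if "k \<in> {1..n-1}" for k
    using that n by (intro Fsum_pos pos) auto
  then have h_nonneg: "0 \<le> hpart n f k" if "k \<in> {1..n-1}" for k
    using that by (intro hpart_nonneg) (simp add: less_imp_le)
  have meas: "(\<lambda>w. ennreal (t k E w)) \<in> borel_measurable (rspm n)" if "E \<in> B k" for k E
  proof -
    have [measurable]: "(\<lambda>w. sum w E) \<in> borel_measurable (rspm n)"
      using that by (intro measurable_sum_weights) (simp add: B_def)
    show ?thesis unfolding t_def by measurable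
  qed
  have part: "(\<Sum>E\<in>B k. \<integral>\<^sup>+w. ennreal (t k E w) \<partial>rspm n) \<le> ennreal (65536 * hpart n f k)"
    if k: "k \<in> A" for k
  proof -
    let ?c = "((real k)\<^sup>2 / (32 * (real n)\<^sup>2)) ^ (k - min k 3) /
      (fact (k - 1) * Fsum f (n - k) ^ (4 - min k 3))"
    have k': "k \<in> {1..n-1}" "(real n)\<^sup>2 * Fsum f (n - k) < (real k)\<^sup>2" using k by (auto simp: A_def)
    have "(\<Sum>E\<in>B k. \<integral>\<^sup>+w. ennreal (t k E w) \<partial>rspm n) \<le> (\<Sum>E\<in>B k. ennreal ?c)"
      unfolding t_def using k' Fpos[OF k'(1)]
      by (intro sum_mono nn_integral_small_edge_sum) (auto simp: B_def)
    also have "\<dots> = ennreal (real (card (edges n) choose k)) * ennreal ?c"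
      using finite_edges by (simp add: B_def n_subsets ennreal_of_nat_eq_real_of_nat)
    also have "\<dots> = ennreal (real (card (edges n) choose k) * ?c)"
      by (rule ennreal_mult'[symmetric]) simp
    also have "\<dots> \<le> ennreal (65536 * hpart n f k)"
      using k' Fpos n by (intro ennreal_leI forest_moment_le_hpart) auto
    finally show ?thesis .
  qed
  have "(\<integral>\<^sup>+w. ennreal (sparse_forest_sum n f w) \<partial>rspm n)
      = (\<integral>\<^sup>+w. (\<Sum>k\<in>A. \<Sum>E\<in>B k. ennreal (t k E w)) \<partial>rspm n)"
    unfolding Z using t_nonneg by (simp add: sum_nonneg)
  also have "\<dots> = (\<Sum>k\<in>A. \<Sum>E\<in>B k. \<integral>\<^sup>+w. ennreal (t k E w) \<partial>rspm n)"
    using meas by (subst nn_integral_sum) (auto simp: nn_integral_sum simp del: sum_ennreal)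
  also have "\<dots> \<le> (\<Sum>k\<in>A. ennreal (65536 * hpart n f k))"
    by (rule sum_mono) (rule part)
  also have "\<dots> = ennreal (\<Sum>k\<in>A. 65536 * hpart n f k)"
    using h_nonneg by (intro sum_ennreal) (simp add: A_def)
  also have "\<dots> \<le> ennreal (\<Sum>k\<in>{1..n-1}. 65536 * hpart n f k)"
    using h_nonneg by (intro ennreal_leI sum_mono2) (auto simp: A_def)
  finally show ?thesis using n by (simp add: hterm_eq_sum sum_distrib_left)
qed

abbreviation main_term :: "real \<Rightarrow> nat \<Rightarrow> (nat \<Rightarrow> real) \<Rightarrow> real" where
  "main_term C n f \<equiv> Max (insert (1 / (Fsum f n)\<^sup>2) ((\<lambda>k. C * gterm n f k) ` {1..n-1}))"

text \<open>Makes the fourth root strictly positive, so that later estimates can divide by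
  it.\<close>

lemma hterm_pos:
  assumes n: "3 \<le> n" and pos: "\<And>i. 1 \<le> i \<Longrightarrow> i \<le> n \<Longrightarrow> 0 < f i"
  shows "0 < hterm n f"
proof -
  have Fpos: "0 < Fsum f (n - k)" if "k \<in> {1..n-1}" for k
    using that n by (intro Fsum_pos pos) auto
  then have h_nonneg: "0 \<le> hpart n f k" if "k \<in> {1..n-1}" for k
    using that by (intro hpart_nonneg) (simp add: less_imp_le)
  have "0 < Fsum f (n - 1)" using n by (intro Fpos) auto
  then have "0 < hpart n f 1"
    using n unfolding hpart_def Let_def
    by (auto intro!: divide_pos_pos add_pos_pos mult_pos_pos)
  then show ?thesis
    unfolding hterm_eq_sum[OF n] using h_nonneg n
    by (intro sum_pos2[of _ 1]) auto
qed

text \<open>With \<open>k\<close> and \<open>E\<close> from \<open>OPT_lower_bound\<close>, either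
  the facility cost is at least \<open>k^2 / n^2\<close>, or the edge sum is at least
  \<open>k^2 / (32 * n^2)\<close>, or the term of \<open>k\<close> and \<open>E\<close> occurs in
  \<open>sparse_forest_sum\<close>. The first two cases lead to the main term.\<close>

lemma inverse_OPT_dichotomy:
  assumes n: "2 \<le> n" and pos: "\<And>i. 1 \<le> i \<Longrightarrow> i \<le> n \<Longrightarrow> 0 < f i"
    and mono: "\<And>i j. 1 \<le> i \<Longrightarrow> i \<le> j \<Longrightarrow> j \<le> n \<Longrightarrow> f i \<le> f j"
    and w: "\<And>e. e \<in> edges n \<Longrightarrow> 0 < w e"
  shows "0 < OPT n f w \<and>
    (1 / OPT n f w \<le> sqrt (main_term 2048 n f) \<or> (1 / OPT n f w) ^ 4 \<le> sparse_forest_sum n f w)"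
proof -
  have Fpos: "0 < Fsum f j" if "1 \<le> j" "j \<le> n" for j
    using that by (intro Fsum_pos pos) auto
  have M: "x \<le> sqrt (main_term 2048 n f)"
    if "x\<^sup>2 = 1 / (Fsum f n)\<^sup>2 \<or> (\<exists>k\<in>{1..n-1}. x\<^sup>2 \<le> 2048 * gterm n f k)" for x
  proof (rule real_le_rsqrt)
    show "x\<^sup>2 \<le> main_term 2048 n f" using that by (auto intro: Max_ge intro!: Max_ge_iff[THEN iffD2])
  qed
  from n have "1 \<le> n" by simp
  from OPT_lower_bound[where f = f and w = w, OF this w mono]
  consider "Fsum f n \<le> OPT n f w"
    | k E where "k \<in> {1..n-1}" "E \<subseteq> edges n" "card E = k"
        "Fsum f (n - k) + sum w E \<le> OPT n f w"
    by blast
  then show ?thesis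
  proof cases
    case 1
    have F: "0 < Fsum f n" using n by (intro Fpos) auto
    have "1 / OPT n f w \<le> 1 / Fsum f n" using 1 F by (intro divide_left_mono) auto
    also have "\<dots> \<le> sqrt (main_term 2048 n f)" by (rule M) (simp add: power_divide)
    finally show ?thesis using 1 F by auto
  next
    case (2 k E)
    define F where "F = Fsum f (n - k)"
    have k1: "1 \<le> k" using 2 by auto
    have F: "0 < F" unfolding F_def using 2 by (intro Fpos) auto
    have wE: "0 \<le> sum w E" using 2 w by (intro sum_nonneg) (auto intro: less_imp_le)
    have opt: "0 < OPT n f w" using 2 F wE unfolding F_def by linarith
    have g: "0 \<le> gterm n f k" using F by (intro gterm_nonneg) (simp add: F_def)
    show ?thesis
    proof (cases "(real k)\<^sup>2 \<le> (real n)\<^sup>2 * F")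
      case True
      have "1 / OPT n f w \<le> 1 / F" using 2 F wE opt by (intro divide_left_mono) (auto simp: F_def)
      also have "\<dots> \<le> sqrt (main_term 2048 n f)"
        using gterm_ge_facility_cost[of f n k] True F g n 2
        by (intro M disjI2 bexI[of _ k]) (auto simp: F_def power_divide)
      finally show ?thesis using opt by auto
    next
      case False
      show ?thesis
      proof (cases "sum w E < (real k)\<^sup>2 / (32 * (real n)\<^sup>2)")
        case small: True
        have "(1 / OPT n f w) ^ 4 \<le> (1 / (F + sum w E)) ^ 4"
          using 2 F wE opt by (intro power_mono divide_left_mono mult_pos_pos) (auto simp: F_def)
        also have "\<dots> = (if sum w E < (real k)\<^sup>2 / (32 * (real n)\<^sup>2)
            then 1 / (Fsum f (n - k) + sum w E) ^ 4 else 0)"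
          using small by (simp add: F_def power_divide)
        also have "\<dots> \<le> (\<Sum>E | E \<subseteq> edges n \<and> card E = k. if sum w E < (real k)\<^sup>2 / (32 * (real n)\<^sup>2)
            then 1 / (Fsum f (n - k) + sum w E) ^ 4 else 0)"
          using 2 finite_edges by (intro member_le_sum) auto
        also have "\<dots> \<le> sparse_forest_sum n f w"
          unfolding sparse_forest_sum_def using False 2
          by (intro member_le_sum[of k _ "\<lambda>k. \<Sum>E | E \<subseteq> edges n \<and> card E = k.
                if sum w E < (real k)\<^sup>2 / (32 * (real n)\<^sup>2)
                then 1 / (Fsum f (n - k) + sum w E) ^ 4 else 0"] sum_nonneg)
             (auto simp: F_def)
        finally show ?thesis using opt by auto
      next
        case large: False
        define r where "r = (real n)\<^sup>2 / (real k)\<^sup>2"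
        have "(real k)\<^sup>2 / (32 * (real n)\<^sup>2) \<le> OPT n f w" using large 2 F by (simp add: F_def)
        then have "1 / OPT n f w \<le> 1 / ((real k)\<^sup>2 / (32 * (real n)\<^sup>2))"
          using k1 n opt by (intro divide_left_mono mult_pos_pos) auto
        also have "\<dots> = 32 * r" by (simp add: r_def)
        also have "\<dots> \<le> sqrt (main_term 2048 n f)"
        \<comment> \<open>The main term carries \<open>2048 = 32^2 * 2\<close>: 32 from the
          threshold, 2 from \<open>gterm_ge_edge_cost\<close>.\<close>
        proof (rule M, intro disjI2 bexI)
          have "r\<^sup>2 \<le> 2 * gterm n f k"
            unfolding r_def using F n k1 False by (intro gterm_ge_edge_cost) (auto simp: F_def)
          then show "(32 * r)\<^sup>2 \<le> 2048 * gterm n f k" by (simp add: power_mult_distrib)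
        qed (use 2 in simp)
        finally show ?thesis using opt by auto
      qed
    qed
  qed
qed

text \<open>Both estimates use Young's inequality in the form \<open>z \<le> \<lambda> + z\<^sup>4 / \<lambda>\<^sup>3\<close> with \<open>\<lambda>\<close> the fourth root
  of (a bound for) the expectation of \<open>z\<^sup>4\<close>.\<close>

lemma nn_integral_const_over_OPT_le:
  assumes n: "3 \<le> n" and pos: "\<And>i. 1 \<le> i \<Longrightarrow> i \<le> n \<Longrightarrow> 0 < f i"
    and mono: "\<And>i j. 1 \<le> i \<Longrightarrow> i \<le> j \<Longrightarrow> j \<le> n \<Longrightarrow> f i \<le> f j" and c: "0 \<le> c"
  shows "(\<integral>\<^sup>+w. ennreal (c / OPT n f w) \<partial>rspm n)
    \<le> ennreal (c * (sqrt (main_term 2048 n f) + 2 * root 4 (65536 * hterm n f)))"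
proof -
  interpret prob_space "rspm n" by (rule prob_space_rspm)
  note [measurable] = measurable_sparse_forest_sum
  define M where "M = sqrt (main_term 2048 n f)"
  define l where "l = root 4 (65536 * hterm n f)"
  define Z where "Z = sparse_forest_sum n f"
  have [measurable]: "Z \<in> borel_measurable (rspm n)" unfolding Z_def by measurable
  have h: "0 < hterm n f" using hterm_pos n pos by blast
  have l: "0 < l" "l ^ 4 = 65536 * hterm n f" using h by (auto simp: l_def)
  have Z0: "0 \<le> Z w" for w by (simp add: Z_def sparse_forest_sum_nonneg)
  have M0: "0 \<le> M" unfolding M_def by (intro real_sqrt_ge_zero Max_ge_iff[THEN iffD2]) auto
  have "AE w in rspm n. c / OPT n f w \<le> c * (M + l) + c / l ^ 3 * Z w"
    using AE_weights_pos
  proof eventually_elim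
    case (elim w)
    then have d: "0 < OPT n f w" "1 / OPT n f w \<le> M \<or> (1 / OPT n f w) ^ 4 \<le> Z w"
      using inverse_OPT_dichotomy[of n f w] n pos mono unfolding M_def Z_def by auto
    define z where "z = 1 / OPT n f w"
    have z: "0 < z" using d by (simp add: z_def)
    \<comment> \<open>If \<open>z\<close> exceeds \<open>M + l\<close>, the dichotomy leaves
      \<open>z^4 \<le> Z w\<close>, and \<open>l \<le> z\<close> gives
      \<open>z * l^3 \<le> z^4\<close>.\<close>
    have "z \<le> M + l + Z w / l ^ 3"
    proof (cases "z \<le> M + l")
      case True
      with Z0[of w] l show ?thesis by (smt (verit) divide_nonneg_pos zero_less_power)
    next
      case False
      then have zl: "l \<le> z" "z ^ 4 \<le> Z w" using d M0 l unfolding z_def by linarith+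
      have "z * l ^ 3 \<le> z * z ^ 3" using zl z l by (intro mult_left_mono power_mono) auto
      also have "\<dots> \<le> Z w" using zl by (simp flip: power_Suc)
      finally have "z \<le> Z w / l ^ 3" using l by (simp add: pos_le_divide_eq)
      then show ?thesis using M0 l by linarith
    qed
    then have "c * z \<le> c * (M + l + Z w / l ^ 3)" using c by (rule mult_left_mono)
    then show ?case by (simp add: z_def algebra_simps)
  qed
  then have "(\<integral>\<^sup>+w. ennreal (c / OPT n f w) \<partial>rspm n)
      \<le> (\<integral>\<^sup>+w. ennreal (c * (M + l)) + ennreal (c / l ^ 3) * ennreal (Z w) \<partial>rspm n)"
    using c l M0 Z0
    by (intro nn_integral_mono_AE) (auto simp: ennreal_leI simp flip: ennreal_mult ennreal_plus)
  also have "\<dots> = ennreal (c * (M + l)) + ennreal (c / l ^ 3) * (\<integral>\<^sup>+w. ennreal (Z w) \<partial>rspm n)"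
    by (simp add: nn_integral_add nn_integral_cmult emeasure_space_1)
  also have "\<dots> \<le> ennreal (c * (M + l)) + ennreal (c / l ^ 3) * ennreal (l ^ 4)"
    unfolding l(2) Z_def
    by (intro add_left_mono mult_left_mono nn_integral_sparse_forest_sum_le n pos) auto
  also have "\<dots> = ennreal (c * (M + l) + c / l ^ 3 * l ^ 4)"
    using c l(1) M0 by (simp flip: ennreal_mult ennreal_plus)
  \<comment> \<open>As \<open>l^4\<close> bounds the expectation of \<open>Z\<close>, the last
    summand is again \<open>c * l\<close>.\<close>
  also have "c * (M + l) + c / l ^ 3 * l ^ 4 = c * (M + 2 * l)"
    using l(1) by (simp add: algebra_simps eval_nat_numeral)
  finally show ?thesis by (simp add: M_def l_def)
qed

lemma nn_integral_over_OPT_le: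
  assumes n: "3 \<le> n" and pos: "\<And>i. 1 \<le> i \<Longrightarrow> i \<le> n \<Longrightarrow> 0 < f i"
    and mono: "\<And>i j. 1 \<le> i \<Longrightarrow> i \<le> j \<Longrightarrow> j \<le> n \<Longrightarrow> f i \<le> f j"
    and X: "X \<in> borel_measurable (rspm n)" and B: "0 \<le> B"
      "(\<integral>\<^sup>+w. ennreal ((X w)\<^sup>2) \<partial>rspm n) \<le> ennreal B"
  shows "(\<integral>\<^sup>+w. ennreal (X w / OPT n f w) \<partial>rspm n)
    \<le> ennreal ((B + 1) * sqrt (main_term 2048 n f) + (B + 2) * root 4 (65536 * hterm n f))"
proof -
  interpret prob_space "rspm n" by (rule prob_space_rspm)
  note [measurable] = measurable_sparse_forest_sum X
  define M where "M = sqrt (main_term 2048 n f)"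
  define l where "l = root 4 (65536 * hterm n f)"
  define Z where "Z = sparse_forest_sum n f"
  have [measurable]: "Z \<in> borel_measurable (rspm n)" unfolding Z_def by measurable
  have h: "0 < hterm n f" using hterm_pos n pos by blast
  have l: "0 < l" "l ^ 4 = 65536 * hterm n f" using h by (auto simp: l_def)
  have Z0: "0 \<le> Z w" for w by (simp add: Z_def sparse_forest_sum_nonneg)
  have M0: "0 \<le> M" unfolding M_def by (intro real_sqrt_ge_zero Max_ge_iff[THEN iffD2]) auto
  have "AE w in rspm n. X w / OPT n f w \<le> (M + l) * (1 + (X w)\<^sup>2) + 1 / l ^ 3 * Z w"
    using AE_weights_pos
  proof eventually_elim
    case (elim w)
    then have d: "0 < OPT n f w" "1 / OPT n f w \<le> M \<or> (1 / OPT n f w) ^ 4 \<le> Z w"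
      using inverse_OPT_dichotomy[of n f w] n pos mono unfolding M_def Z_def by auto
    define z where "z = 1 / OPT n f w"
    have z: "0 < z" using d by (simp add: z_def)
    define x where "x = X w"
    \<comment> \<open>Only the second moment of \<open>X\<close> is controlled, so \<open>x\<close>
      is traded for \<open>1 + x^2\<close>.\<close>
    have x1: "x \<le> 1 + x\<^sup>2"
      using sum_squares_bound[of x 1] zero_le_power2[of x] by (simp only: mult_1_right one_power2)
    have q: "0 \<le> Z w / l ^ 3" using Z0[of w] l by simp
    have "x * z \<le> (M + l) * (1 + x\<^sup>2) + Z w / l ^ 3"
    proof (cases "z \<le> M + l")
      case True
      have "x * z \<le> (1 + x\<^sup>2) * (M + l)"
        using x1 True z M0 l by (intro mult_mono) auto
      then show ?thesis using q by (simp add: mult.commute)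
    next
      case False
      then have zl: "l \<le> z" "z ^ 4 \<le> Z w" using d M0 l unfolding z_def by linarith+
      \<comment> \<open>Normalised so that \<open>1 \<le> y\<close>, hence
        \<open>y^2 \<le> y^4\<close>; multiplying by \<open>l\<close> then bounds
        \<open>x * z\<close> by \<open>l * x^2 + z^4 / l^3\<close>.\<close>
      define y where "y = z / l"
      have y: "1 \<le> y" using zl l by (simp add: y_def)
      have "x * y \<le> x\<^sup>2 + y\<^sup>2"
        using sum_squares_bound[of x y] zero_le_power2[of x] zero_le_power2[of y]
        by (simp only: mult.assoc)
      also have "y\<^sup>2 \<le> y ^ 4" using y by (intro power_increasing) auto
      finally have "l * (x * y) \<le> l * (x\<^sup>2 + y ^ 4)" using l by (intro mult_left_mono) auto
      moreover have "l * (x * y) = x * z" using l by (simp add: y_def)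
      moreover have "l * y ^ 4 = z ^ 4 / l ^ 3"
        using l(1) by (simp add: y_def power_divide eval_nat_numeral)
      moreover have "z ^ 4 / l ^ 3 \<le> Z w / l ^ 3" using zl l by (intro divide_right_mono) auto
      moreover have "l * x\<^sup>2 \<le> (M + l) * (1 + x\<^sup>2)" using M0 l by (intro mult_mono) auto
      ultimately show ?thesis by (simp add: distrib_left)
    qed
    then show ?case by (simp add: z_def x_def)
  qed
  then have "(\<integral>\<^sup>+w. ennreal (X w / OPT n f w) \<partial>rspm n)
      \<le> (\<integral>\<^sup>+w. ennreal (M + l) * (1 + ennreal ((X w)\<^sup>2)) + ennreal (1 / l ^ 3) * ennreal (Z w) \<partial>rspm n)"
    using l M0 Z0
    by (intro nn_integral_mono_AE)
       (auto simp: ennreal_leI simp flip: ennreal_mult ennreal_plus ennreal_1)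
  also have "\<dots> = ennreal (M + l) * (1 + (\<integral>\<^sup>+w. ennreal ((X w)\<^sup>2) \<partial>rspm n))
      + ennreal (1 / l ^ 3) * (\<integral>\<^sup>+w. ennreal (Z w) \<partial>rspm n)"
    by (simp add: nn_integral_add nn_integral_cmult emeasure_space_1)
  also have "\<dots> \<le> ennreal (M + l) * (1 + ennreal B) + ennreal (1 / l ^ 3) * ennreal (l ^ 4)"
    unfolding l(2) Z_def
    by (intro add_mono mult_left_mono nn_integral_sparse_forest_sum_le n pos B order_refl) auto
  also have "\<dots> = ennreal ((M + l) * (1 + B) + 1 / l ^ 3 * l ^ 4)"
    using B(1) l(1) M0 by (simp flip: ennreal_mult ennreal_plus ennreal_1)
  also have "(M + l) * (1 + B) + 1 / l ^ 3 * l ^ 4 = (B + 1) * M + (B + 2) * l"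
    using l(1) by (simp add: algebra_simps eval_nat_numeral)
  finally show ?thesis by (simp add: M_def l_def)
qed

section \<open>Scaling of the constants and properties of \<open>kappa\<close>\<close>

lemma main_term_mono:
  assumes "C \<le> D" "\<And>k. k \<in> {1..n-1} \<Longrightarrow> 0 \<le> gterm n f k"
  shows "main_term C n f \<le> main_term D n f"
proof -
  have "C * gterm n f k \<le> main_term D n f" if k: "k \<in> {1..n-1}" for k
  proof -
    have "C * gterm n f k \<le> D * gterm n f k" using assms k by (intro mult_right_mono) auto
    also have "\<dots> \<le> main_term D n f" using k by (intro Max_ge) auto
    finally show ?thesis .
  qed
  then show ?thesis by (intro Max.boundedI) auto
qed

text \<open>Every cost up to index \<open>kappa\<close> is at most the last one, which is below
  \<open>1 / (kappa - 1)\<close>, and \<open>kappa / (kappa - 1)\<close> is at most 2.\<close>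

lemma Fsum_kappa_le_2:
  assumes "2 \<le> kappa n f" "1 \<le> n"
    and mono: "\<And>i j. 1 \<le> i \<Longrightarrow> i \<le> j \<Longrightarrow> j \<le> n \<Longrightarrow> f i \<le> f j"
  shows "Fsum f (kappa n f) \<le> 2"
proof -
  let ?k = "kappa n f"
  have "?k \<in> {i \<in> {1..n}. i = 1 \<or> f i < 1 / (real i - 1)}"
    unfolding kappa_def using assms(2) by (intro Max_in) auto
  then have k: "?k \<le> n" "f ?k < 1 / (real ?k - 1)" using assms(1) by auto
  have "Fsum f ?k \<le> (\<Sum>i=1..?k. f ?k)"
    unfolding Fsum_def using k by (intro sum_mono mono) auto
  also have "\<dots> = real ?k * f ?k" by simp
  also have "\<dots> \<le> real ?k * (1 / (real ?k - 1))" using k by (intro mult_left_mono) auto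
  also have "\<dots> \<le> 2" using assms(1) by (simp add: field_simps)
  finally show ?thesis .
qed

lemma kappa_bounds: "1 \<le> n \<Longrightarrow> 1 \<le> kappa n f \<and> kappa n f \<le> n"
proof -
  assume "1 \<le> n"
  then have "kappa n f \<in> {i \<in> {1..n}. i = 1 \<or> f i < 1 / (real i - 1)}"
    unfolding kappa_def by (intro Max_in) auto
  then show ?thesis by auto
qed

text \<open>Since \<open>n - 1 \<le> n^2\<close>, the last index already satisfies the inequality
  defining \<open>kappa\<close>. This serves instances whose total opening cost is too small for
  \<open>nn_integral_ALG_le\<close>.\<close>

lemma kappa_eq_n:
  assumes "1 \<le> n" "f n < 1 / (real n)\<^sup>2"
  shows "kappa n f = n"
proof -
  have "n = 1 \<or> f n < 1 / (real n - 1)"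
  proof (cases "n = 1")
    case False
    with assms(1) have "2 \<le> n" by simp
    then have "real n * 1 \<le> real n * real n" by (intro mult_left_mono) auto
    then have "real n - 1 \<le> (real n)\<^sup>2" unfolding power2_eq_square by linarith
    then have "1 / (real n)\<^sup>2 \<le> 1 / (real n - 1)" using \<open>2 \<le> n\<close> by (intro divide_left_mono) auto
    with assms(2) show ?thesis by simp
  qed simp
  with assms(1) show ?thesis unfolding kappa_def by (intro Max_eqI) auto
qed

text \<open>All facilities are open, so \<open>ALG\<close> is at most the deterministic
  \<open>Fsum f n\<close>, and no constant is lost on the entry
  \<open>1 / (Fsum f n)^2\<close>.\<close>

lemma nn_integral_ALG_kappa_n_le:
  assumes n: "3 \<le> n" and pos: "\<And>i. 1 \<le> i \<Longrightarrow> i \<le> n \<Longrightarrow> 0 < f i"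
    and mono: "\<And>i j. 1 \<le> i \<Longrightarrow> i \<le> j \<Longrightarrow> j \<le> n \<Longrightarrow> f i \<le> f j"
    and kappa: "kappa n f = n" and C: "1048576 \<le> C"
  shows "(\<integral>\<^sup>+w. ennreal (ALG n f w / OPT n f w) \<partial>rspm n) \<le> ennreal (Fsum f n * bound C n f)"
proof -
  have Fpos: "0 < Fsum f j" if "1 \<le> j" "j \<le> n" for j
    using that by (intro Fsum_pos pos) auto
  have F: "0 < Fsum f n" using n by (intro Fpos) auto
  have h: "0 < hterm n f" using hterm_pos n pos by blast
  have alg: "ALG n f w \<le> Fsum f n" for w
    using flcost_prefix_le[of n n f w] n by (simp add: ALG_def kappa)
  have "AE w in rspm n. ALG n f w / OPT n f w \<le> Fsum f n / OPT n f w"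
    using AE_weights_pos
  proof eventually_elim
    case (elim w)
    then have "0 < OPT n f w" using inverse_OPT_dichotomy[of n f w] n pos mono by auto
    then show ?case using alg[of w] by (intro divide_right_mono) auto
  qed
  then have "(\<integral>\<^sup>+w. ennreal (ALG n f w / OPT n f w) \<partial>rspm n)
      \<le> (\<integral>\<^sup>+w. ennreal (Fsum f n / OPT n f w) \<partial>rspm n)"
    by (intro nn_integral_mono_AE) (auto intro: ennreal_leI)
  also have "\<dots> \<le> ennreal (Fsum f n * (sqrt (main_term 2048 n f) + 2 * root 4 (65536 * hterm n f)))"
    using F by (intro nn_integral_const_over_OPT_le n pos mono) auto
  also have "\<dots> \<le> ennreal (Fsum f n * bound C n f)"
  proof (intro ennreal_leI mult_left_mono)
    \<comment> \<open>The factor \<open>2 = root 4 16\<close> moves into the root, and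
      \<open>16 * 65536 = 1048576\<close>.\<close>
    have "2 * root 4 (65536 * hterm n f) = root 4 16 * root 4 (65536 * hterm n f)"
      using real_root_power_cancel[of 4 "2::real"] by simp
    also have "\<dots> = root 4 (16 * (65536 * hterm n f))" by (simp only: real_root_mult)
    also have "\<dots> \<le> root 4 (C * hterm n f)" using C h by simp
    finally have "2 * root 4 (65536 * hterm n f) \<le> root 4 (C * hterm n f)" .
    moreover have "sqrt (main_term 2048 n f) \<le> sqrt (main_term C n f)"
      using C n Fpos by (intro real_sqrt_le_mono main_term_mono gterm_nonneg) (auto intro!: less_imp_le)
    ultimately show "sqrt (main_term 2048 n f) + 2 * root 4 (65536 * hterm n f) \<le> bound C n f"
      unfolding bound_def by linarith
  qed (use F in simp)
  finally show ?thesis .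
qed

text \<open>The factor \<open>B + 1\<close> must be absorbed by the O-constant, but the entry
  \<open>1 / (Fsum f n)^2\<close> of the maximum does not scale with it. Hypothesis
  \<open>Fn\<close> bounds that entry by \<open>2 * gterm n f 1\<close>, which belongs to an entry
  that does scale.\<close>

lemma nn_integral_ALG_le:
  assumes n: "3 \<le> n" and pos: "\<And>i. 1 \<le> i \<Longrightarrow> i \<le> n \<Longrightarrow> 0 < f i"
    and mono: "\<And>i j. 1 \<le> i \<Longrightarrow> i \<le> j \<Longrightarrow> j \<le> n \<Longrightarrow> f i \<le> f j"
    and kappa: "2 \<le> kappa n f" and B: "8 + 4 * (real n / real (kappa n f))\<^sup>2 \<le> B"
    and Fn: "1 / (real n)\<^sup>2 \<le> Fsum f n" and C: "1048576 * (B + 2) ^ 4 \<le> C"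
  shows "(\<integral>\<^sup>+w. ennreal (ALG n f w / OPT n f w) \<partial>rspm n) \<le> ennreal (bound C n f)"
proof -
  let ?k = "kappa n f"
  have Fpos: "0 < Fsum f j" if "1 \<le> j" "j \<le> n" for j
    using that by (intro Fsum_pos pos) auto
  have F: "0 < Fsum f n" using n by (intro Fpos) auto
  have h: "0 < hterm n f" using hterm_pos n pos by blast
  have g: "0 \<le> gterm n f k" if "k \<in> {1..n-1}" for k
  proof -
    have "0 < Fsum f (n - k)" using that n by (intro Fpos) auto
    then show ?thesis by (intro gterm_nonneg) simp
  qed
  have B0: "8 \<le> B" using B zero_le_power2[of "real n / real ?k"] by linarith
  have k: "1 \<le> ?k" "?k \<le> n" using kappa_bounds[of n f] n by auto
  define X where "X = (\<lambda>w :: nat set \<Rightarrow> real. 2 + (\<Sum>v\<in>{?k<..n}. Min (w ` star ?k v)))"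
  have X: "X \<in> borel_measurable (rspm n)"
    unfolding X_def using k by (intro borel_measurable_add borel_measurable_const
        borel_measurable_sum measurable_Min_star) auto
  have alg: "ALG n f w \<le> X w" for w
    using flcost_prefix_le[of ?k n f w] k Fsum_kappa_le_2[of n f] kappa mono n
    by (simp add: ALG_def X_def)
  have X2: "(\<integral>\<^sup>+w. ennreal ((X w)\<^sup>2) \<partial>rspm n) \<le> ennreal B"
  proof -
    have "(\<integral>\<^sup>+w. ennreal ((X w)\<^sup>2) \<partial>rspm n) \<le> ennreal (2 * 2\<^sup>2 + 4 * (real n / real ?k)\<^sup>2)"
      unfolding X_def by (rule nn_integral_prefix_cost_squared) (rule k)
    also have "\<dots> \<le> ennreal B" using B by (intro ennreal_leI) simp
    finally show ?thesis .
  qed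
  have "AE w in rspm n. ALG n f w / OPT n f w \<le> X w / OPT n f w"
    using AE_weights_pos
  proof eventually_elim
    case (elim w)
    then have "0 < OPT n f w" using inverse_OPT_dichotomy[of n f w] n pos mono by auto
    then show ?case using alg[of w] by (intro divide_right_mono) auto
  qed
  then have "(\<integral>\<^sup>+w. ennreal (ALG n f w / OPT n f w) \<partial>rspm n)
      \<le> (\<integral>\<^sup>+w. ennreal (X w / OPT n f w) \<partial>rspm n)"
    by (intro nn_integral_mono_AE) (auto intro: ennreal_leI)
  also have "\<dots> \<le> ennreal ((B + 1) * sqrt (main_term 2048 n f) + (B + 2) * root 4 (65536 * hterm n f))"
    using B0 by (intro nn_integral_over_OPT_le n pos mono X X2) auto
  also have "\<dots> \<le> ennreal (bound C n f)"
  proof (intro ennreal_leI)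
    have sq: "(B + 1)\<^sup>2 * 2048 \<le> C"
    proof -
      have "(B + 1)\<^sup>2 * 2048 \<le> (B + 2)\<^sup>2 * 1048576" using B0 by (intro mult_mono power_mono) auto
      also have "\<dots> \<le> (B + 2) ^ 4 * 1048576" using B0 by (intro mult_right_mono power_increasing) auto
      finally show ?thesis using C by simp
    qed
    have "main_term 2048 n f \<in> insert (1 / (Fsum f n)\<^sup>2) ((\<lambda>k. 2048 * gterm n f k) ` {1..n-1})"
      by (rule Max_in) auto
    then have "\<exists>k\<in>{1..n-1}. main_term 2048 n f \<le> 2048 * gterm n f k"
    proof
      assume M: "main_term 2048 n f = 1 / (Fsum f n)\<^sup>2"
      have F1: "0 < Fsum f (n - 1)" using n by (intro Fpos) auto
      \<comment> \<open>Compare \<open>Fsum f (n - 1)\<close> with \<open>1 / n^2\<close>: if it is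
        large, pass from \<open>n\<close> to \<open>n - 1\<close> facilities; if it is small,
        \<open>Fn\<close> bounds the left side by \<open>n^4\<close>, the edge-cost regime of
        \<open>gterm n f 1\<close>.\<close>
      have "1 / (Fsum f n)\<^sup>2 \<le> 2 * gterm n f 1"
      proof (cases "1 \<le> (real n)\<^sup>2 * Fsum f (n - 1)")
        case True
        have "Fsum f (n - 1) \<le> Fsum f n"
          unfolding Fsum_def using pos by (intro sum_mono2) (auto intro!: less_imp_le)
        then have "1 / (Fsum f n)\<^sup>2 \<le> 1 / (Fsum f (n - 1))\<^sup>2"
          using F F1 by (intro divide_left_mono power_mono mult_pos_pos) auto
        also have "\<dots> \<le> 2 * gterm n f 1"
          using F1 n True by (intro gterm_ge_facility_cost) auto
        finally show ?thesis .
      next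
        case False
        have "1 / (Fsum f n)\<^sup>2 = (1 / Fsum f n)\<^sup>2" by (simp add: power_divide)
        also have "\<dots> \<le> ((real n)\<^sup>2)\<^sup>2"
          using Fn F n by (intro power_mono) (auto simp: field_simps)
        also have "\<dots> \<le> 2 * gterm n f 1"
          using gterm_ge_edge_cost[of f n 1] F1 n False by simp
        finally show ?thesis .
      qed
      moreover have one: "1 \<in> {1..n-1}" using n by simp
      ultimately have "main_term 2048 n f \<le> 2048 * gterm n f 1" using M g[OF one] by linarith
      then show ?thesis using one by blast
    next
      assume "main_term 2048 n f \<in> (\<lambda>k. 2048 * gterm n f k) ` {1..n-1}"
      then show ?thesis by (metis (no_types, lifting) imageE order_refl)
    qed
    then obtain k where kk: "k \<in> {1..n-1}" "main_term 2048 n f \<le> 2048 * gterm n f k" by blast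
    have "(B + 1) * sqrt (main_term 2048 n f) = sqrt ((B + 1)\<^sup>2 * main_term 2048 n f)"
      using B0 by (simp add: real_sqrt_mult)
    also have "\<dots> \<le> sqrt (main_term C n f)"
    proof (rule real_sqrt_le_mono)
      have "(B + 1)\<^sup>2 * main_term 2048 n f \<le> (B + 1)\<^sup>2 * (2048 * gterm n f k)"
        using kk by (intro mult_left_mono) auto
      also have "\<dots> \<le> C * gterm n f k"
        using sq g[OF kk(1)] by (simp add: mult_right_mono flip: mult.assoc)
      also have "\<dots> \<le> main_term C n f" using kk by (intro Max_ge) auto
      finally show "(B + 1)\<^sup>2 * main_term 2048 n f \<le> main_term C n f" .
    qed
    finally have 1: "(B + 1) * sqrt (main_term 2048 n f) \<le> sqrt (main_term C n f)" .
    have "(B + 2) * root 4 (65536 * hterm n f) = root 4 ((B + 2) ^ 4) * root 4 (65536 * hterm n f)"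
      using B0 by (simp add: real_root_power_cancel)
    also have "\<dots> = root 4 ((B + 2) ^ 4 * 65536 * hterm n f)" by (simp add: real_root_mult)
    also have "\<dots> \<le> root 4 (C * hterm n f)"
    proof -
      have "(B + 2) ^ 4 * 65536 \<le> (B + 2) ^ 4 * 1048576" using B0 by (intro mult_left_mono) auto
      then have "(B + 2) ^ 4 * 65536 \<le> C" using C by linarith
      then show ?thesis using h by simp
    qed
    finally show "(B + 1) * sqrt (main_term 2048 n f) + (B + 2) * root 4 (65536 * hterm n f)
        \<le> bound C n f"
      using 1 unfolding bound_def by linarith
  qed
  finally show ?thesis .
qed

text \<open>The expectation is a nonnegative extended integral, so each estimate includes
  finiteness; in each claim a single \<open>C\<close> serves all the hidden constants.\<close>

theorem theorem2:
  fixes f :: "nat \<Rightarrow> nat \<Rightarrow> real"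
  assumes pos: "\<And>n i. 1 \<le> i \<Longrightarrow> i \<le> n \<Longrightarrow> 0 < f n i"
    and mono: "\<And>n i j. 1 \<le> i \<Longrightarrow> i \<le> j \<Longrightarrow> j \<le> n \<Longrightarrow> f n i \<le> f n j"
    and ratio: "\<exists>q::real. \<forall>n\<ge>1. f n n / f n 1 \<le> real n powr q"
    and kappa_lin: "(\<lambda>n. real (kappa n (f n))) \<in> \<Theta>(\<lambda>n. real n)"
  shows "(\<exists>C>0. \<exists>N. \<forall>n\<ge>N.
            (\<integral>\<^sup>+ w. ennreal (ALG n (f n) w / OPT n (f n) w) \<partial>rspm n)
              \<le> ennreal (bound C n (f n)))
       \<and> ((\<forall>n\<ge>1. kappa n (f n) = n) \<longrightarrow>
          (\<exists>C>0. \<exists>N. \<forall>n\<ge>N.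
            (\<integral>\<^sup>+ w. ennreal (ALG n (f n) w / OPT n (f n) w) \<partial>rspm n)
              \<le> ennreal (Fsum (f n) n * bound C n (f n))))"
proof (intro conjI impI)
  from kappa_lin obtain c where c: "c > 0"
      "eventually (\<lambda>n. norm (real (kappa n (f n))) \<ge> c * norm (real n)) at_top"
    by (blast dest: bigthetaD2 elim: landau_omega.bigE)
  then obtain N where N: "\<And>n. N \<le> n \<Longrightarrow> c * real n \<le> real (kappa n (f n))"
    by (auto simp: eventually_at_top_linorder)
  \<comment> \<open>The second-moment bound of \<open>nn_integral_prefix_cost_squared\<close> for
    opening costs at most 2 and \<open>n / kappa \<le> 1 / c\<close>.\<close>
  define B where "B = 8 + 4 * (1 / c)\<^sup>2"
  define C where "C = 1048576 * (B + 2) ^ 4"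
  have B: "8 \<le> B" by (simp add: B_def)
  have C: "1048576 \<le> C" using B one_le_power[of "B + 2" 4] by (simp add: C_def)
  \<comment> \<open>From \<open>2 / c\<close> on, \<open>kappa\<close> is at least
    \<open>c * n \<ge> 2\<close>; the 3 puts the two exceptional summands of \<open>hterm\<close> in
    range.\<close>
  define N' where "N' = max 3 (max N (nat \<lceil>2 / c\<rceil>))"
  have "(\<integral>\<^sup>+ w. ennreal (ALG n (f n) w / OPT n (f n) w) \<partial>rspm n) \<le> ennreal (bound C n (f n))"
    if "N' \<le> n" for n
  proof -
    have n: "3 \<le> n" "N \<le> n" "2 / c \<le> real n" using that by (auto simp: N'_def)
    show ?thesis
    proof (cases "1 / (real n)\<^sup>2 \<le> Fsum (f n) n")
      case True
      have "2 \<le> c * real n" using n c by (simp add: field_simps)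
      with N[OF n(2)] have kappa: "2 \<le> kappa n (f n)" by linarith
      have "real n / real (kappa n (f n)) \<le> 1 / c"
        using N[OF n(2)] c kappa by (simp add: field_simps)
      then have "(real n / real (kappa n (f n)))\<^sup>2 \<le> (1 / c)\<^sup>2" by (intro power_mono) auto
      then show ?thesis
        by (intro nn_integral_ALG_le[where B = B] n pos mono kappa True) (auto simp: B_def C_def)
    next
      case False
      \<comment> \<open>A total cost below \<open>1 / n^2\<close> forces \<open>kappa = n\<close>,
        and then the bound with the extra factor \<open>Fsum (f n) n \<le> 1\<close> is even
        stronger.\<close>
      have "f n n \<le> Fsum (f n) n"
        unfolding Fsum_def using pos[of _ n] n by (intro member_le_sum) (auto intro: less_imp_le)
      with False have "kappa n (f n) = n" using n by (intro kappa_eq_n) auto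
      then have "(\<integral>\<^sup>+ w. ennreal (ALG n (f n) w / OPT n (f n) w) \<partial>rspm n)
          \<le> ennreal (Fsum (f n) n * bound C n (f n))"
        using n pos mono C by (intro nn_integral_ALG_kappa_n_le) auto
      also have "\<dots> \<le> ennreal (bound C n (f n))"
      proof (intro ennreal_leI mult_left_le_one_le)
        have "0 \<le> main_term C n (f n)" by (intro Max_ge_iff[THEN iffD2]) auto
        moreover have "0 < hterm n (f n)" using hterm_pos n pos by blast
        ultimately show "0 \<le> bound C n (f n)" using C by (auto simp: bound_def)
        have "0 < Fsum (f n) n" using n pos[of _ n] by (intro Fsum_pos) auto
        then show "0 \<le> Fsum (f n) n" by simp
        have "1 / (real n)\<^sup>2 \<le> 1" using n by (simp add: field_simps)
        then show "Fsum (f n) n \<le> 1" using False by linarith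
      qed
      finally show ?thesis .
    qed
  qed
  then show "\<exists>C>0. \<exists>N. \<forall>n\<ge>N.
      (\<integral>\<^sup>+ w. ennreal (ALG n (f n) w / OPT n (f n) w) \<partial>rspm n) \<le> ennreal (bound C n (f n))"
    using C by (intro exI[of _ C] conjI exI[of _ N']) auto
next
  assume kappa: "\<forall>n\<ge>1. kappa n (f n) = n"
  show "\<exists>C>0. \<exists>N. \<forall>n\<ge>N. (\<integral>\<^sup>+ w. ennreal (ALG n (f n) w / OPT n (f n) w) \<partial>rspm n)
      \<le> ennreal (Fsum (f n) n * bound C n (f n))"
    using kappa pos mono
    by (intro exI[of _ 1048576] conjI exI[of _ 3] allI impI nn_integral_ALG_kappa_n_le) auto
qed

end
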